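(* Let $\omega$, $d$, $(K,\mathcal{P},\mathcal{N})$, $h_K$, $\omega_K$, $\Pi_K$, $k$ and the constants $C_\dag, C_\flat, C_\sharp, C_\diamond$ be as in the context, satisfying assumptions (A1)--(A8) listed there. Then there exists a positive constant $C$, depending only on $N$, $n$, $k$, $C_\dag$, $C_\flat$, $C_\sharp$ and $C_\diamond$, such that for all integers $m,\ell,n$ with $0\leq m\leq k$, $0\leq \ell\leq m+1$ and $n\geq 1$, $$|\omega^{n}\chi-\Pi_K(\omega^{n}\chi)|_{H^\ell(K)}\leq C\,h_K^{m+1-\ell}\,d^{-(m+1)}\sum_{j=0}^{m} d^j |\chi|_{H^j(K)}\qquad\forall\,\chi\in\mathcal{P},$$ and, if moreover $n\geq m+1$, $$|\omega^{n}\chi-\Pi_K(\omega^{n}\chi)|_{H^\ell(K)}\leq C\,h_K^{m+1-\ell}\,d^{-(m+1)}\sum_{j=0}^{m} d^j |\omega^j\chi|_{H^j(K)}\qquad\forall\,\chi\in\mathcal{P}.$$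
   Context: Notation. $W^j_s$ denotes the usual Sobolev space of functions with weak derivatives up to order $j$ in $L_s$, and $|\cdot|_{W^j_s}$ its usual seminorm involving only the derivatives of order exactly $j$; $H^j=W^j_2$; for $j=0$ the seminorm is the $L_s$ norm. One writes $H^\ell(K)$ and $W^\ell_s(K)$ for $H^\ell(\mathrm{int}(K))$ and $W^\ell_s(\mathrm{int}(K))$. Zeroth powers are equal to $1$. Setting. $\omega$ is a $C^\infty$ function on $\mathbb{R}^N$ and $d$ is a positive number. $(K,\mathcal{P},\mathcal{N})$ is a finite element in the sense of Ciarlet (so $K$ has nonempty interior and piecewise smooth boundary, and $\mathcal{N}$ is a basis of the dual space of $\mathcal{P}$), where $K$ is a connected compact subset of $\mathbb{R}^N$ with diameter $h_K$, $\mathcal{P}$ is a finite dimensional vector space of polynomials (regarded as functions on $K$), and $\mathcal{N}$ is a set of nodal variables (degrees of freedom). $\omega_K$ is the mean of $\omega$ over $K$. The linear operator $\Pi_K:C^\infty(K)\to\mathcal{P}$ is the nodal interpolation operator, i.e. $\Pi_K\zeta$ is the element of $\mathcal{P}$ with the same values of all nodal variables in $\mathcal{N}$ as $\zeta$. $k$ is a positive integer (depending on the maximum order of differentiation among the nodal variables), and $C_\dag,C_\flat,C_\sharp,C_\diamond$ are positive constants. Assumptions: (A1) $|\omega|_{W^j_\infty(\mathbb{R}^N)}\leq C_\dag d^{-j}$ for $j=0,1,2,\ldots$. (A2) $h_K\leq d$. (A3) $|\omega_K|\leq C_\dag$. (A4) $|\omega-\omega_K|_{L_\infty(K)}\leq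 C_\dag d^{-1}h_K$. (A5) $\zeta-\Pi_K\zeta=0$ for all $\zeta\in\mathcal{P}$. (A6) $|\zeta-\Pi_K\zeta|_{W^\ell_\infty(K)}\leq C_\flat h_K^{k+1-\ell}|\zeta|_{W^{k+1}_\infty(K)}$ for all $\zeta\in C^\infty(K)$ and $0\leq\ell\leq k+1$. (A7) $|\chi|_{W^q_s(K)}\leq C_\sharp h_K^{p-q}|\chi|_{W^p_s(K)}$ for all $\chi\in\mathcal{P}$, $s=2,\infty$, and $0\leq p<q\leq k+1$. (A8) $|\chi|_{W^p_\infty(K)}\leq C_\diamond h_K^{-N/2}|\chi|_{H^p(K)}$ for all $\chi\in\mathcal{P}$ and $0\leq p\leq k$. *)

theory Defs
  imports
    "HOL-Analysis.Analysis"
    "HOL-Library.Function_Algebras"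
    "HOL-Probability.Essential_Supremum"
begin

primrec Ck_on :: "nat \<Rightarrow> 'a::real_normed_vector set \<Rightarrow> ('a \<Rightarrow> real) \<Rightarrow> bool" where
  "Ck_on 0 S f \<longleftrightarrow> continuous_on S f"
| "Ck_on (Suc k) S f \<longleftrightarrow>
     (\<forall>x\<in>S. f differentiable (at x)) \<and> (\<forall>v. Ck_on k S (\<lambda>x. frechet_derivative f (at x) v))"

(* Only meaningful for open S. *)
definition smooth_on :: "'a::real_normed_vector set \<Rightarrow> ('a \<Rightarrow> real) \<Rightarrow> bool" where
  "smooth_on S f \<longleftrightarrow> (\<forall>k. Ck_on k S f)"

(* The space C^infinity(K) for a closed set K. Its elements are functions on K; they are represented
   by total functions whose values off K are irrelevant. *)
definition Cinf :: "'a::real_normed_vector set \<Rightarrow> ('a \<Rightarrow> real) set" where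
  "Cinf K = {f. \<exists>g. smooth_on UNIV g \<and> (\<forall>x\<in>K. f x = g x)}"

primrec pderivs :: "'n list \<Rightarrow> (real ^ 'n::finite \<Rightarrow> real) \<Rightarrow> real ^ 'n \<Rightarrow> real" where
  "pderivs [] f = f"
| "pderivs (i # xs) f = pderivs xs (\<lambda>x. frechet_derivative f (at x) (axis i 1))"

(* Multi-indices are functions 'n \<Rightarrow> nat. The list below fixes some order of differentiation,
   which does not matter for smooth functions; mderiv is applied only to those. *)
definition mderiv :: "('n \<Rightarrow> nat) \<Rightarrow> (real ^ 'n::finite \<Rightarrow> real) \<Rightarrow> real ^ 'n \<Rightarrow> real" where
  "mderiv \<alpha> f = pderivs (SOME xs. \<forall>i. count_list xs i = \<alpha> i) f"

definition test_functions :: "'a::real_normed_vector set \<Rightarrow> ('a \<Rightarrow> real) set" where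
  "test_functions U =
     {\<phi>. smooth_on UNIV \<phi> \<and> compact (closure {x. \<phi> x \<noteq> 0}) \<and> closure {x. \<phi> x \<noteq> 0} \<subseteq> U}"

definition locally_integrable_on ::
  "'a::euclidean_space set \<Rightarrow> ('a \<Rightarrow> real) \<Rightarrow> bool" where
  "locally_integrable_on U f \<longleftrightarrow> (\<forall>S. compact S \<and> S \<subseteq> U \<longrightarrow> set_integrable lebesgue S f)"

definition is_weak_deriv ::
  "(real ^ 'n::finite) set \<Rightarrow> ('n \<Rightarrow> nat) \<Rightarrow> (real ^ 'n \<Rightarrow> real) \<Rightarrow> (real ^ 'n \<Rightarrow> real) \<Rightarrow> bool" where
  "is_weak_deriv U \<alpha> f g \<longleftrightarrow>
     locally_integrable_on U f \<and> locally_integrable_on U g \<and>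
     (\<forall>\<phi>\<in>test_functions U.
        (LINT x:U|lebesgue. f x * mderiv \<alpha> \<phi> x) =
        (- 1) ^ sum \<alpha> UNIV * (LINT x:U|lebesgue. g x * \<phi> x))"

(* Determined up to a null subset of U. *)
definition weak_deriv ::
  "(real ^ 'n::finite) set \<Rightarrow> ('n \<Rightarrow> nat) \<Rightarrow> (real ^ 'n \<Rightarrow> real) \<Rightarrow> real ^ 'n \<Rightarrow> real" where
  "weak_deriv U \<alpha> f = (SOME g. is_weak_deriv U \<alpha> f g)"

definition ennreal_powr :: "ennreal \<Rightarrow> real \<Rightarrow> ennreal" where
  "ennreal_powr x r = (if x = \<infinity> then \<infinity> else ennreal (enn2real x powr r))"

(* For 1 \<le> s \<le> \<infinity>; the value is \<infinity> outside the space L_s(U). *)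
definition Lp_norm :: "ennreal \<Rightarrow> 'a::euclidean_space set \<Rightarrow> ('a \<Rightarrow> real) \<Rightarrow> ennreal" where
  "Lp_norm s U f =
     (if f \<notin> borel_measurable (lebesgue_on U) then \<infinity>
      else if s = \<infinity> then esssup (lebesgue_on U) (\<lambda>x. ennreal \<bar>f x\<bar>)
      else ennreal_powr (\<integral>\<^sup>+ x. ennreal (\<bar>f x\<bar> powr enn2real s) \<partial>lebesgue_on U) (1 / enn2real s))"

definition sobolev_space :: "nat \<Rightarrow> ennreal \<Rightarrow> (real ^ 'n::finite) set \<Rightarrow> (real ^ 'n \<Rightarrow> real) set" where
  "sobolev_space j s U =
     {f. \<forall>\<alpha>. sum \<alpha> UNIV \<le> j \<longrightarrow> (\<exists>g. is_weak_deriv U \<alpha> f g \<and> Lp_norm s U g < \<infinity>)}"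

(* The value is \<infinity> outside the Sobolev space. *)
definition sobolev_seminorm ::
  "nat \<Rightarrow> ennreal \<Rightarrow> (real ^ 'n::finite) set \<Rightarrow> (real ^ 'n \<Rightarrow> real) \<Rightarrow> ennreal" where
  "sobolev_seminorm j s U f =
     (if f \<notin> sobolev_space j s U then \<infinity>
      else if s = \<infinity> then (SUP \<alpha>\<in>{\<alpha>. sum \<alpha> UNIV = j}. Lp_norm s U (weak_deriv U \<alpha> f))
      else ennreal_powr
        (\<Sum>\<alpha> | sum \<alpha> UNIV = j. ennreal_powr (Lp_norm s U (weak_deriv U \<alpha> f)) (enn2real s))
        (1 / enn2real s))"

definition mean_on :: "'a::euclidean_space set \<Rightarrow> ('a \<Rightarrow> real) \<Rightarrow> real" where
  "mean_on K f = (LINT x:K|lebesgue. f x) / measure lebesgue K"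

(* The boundary is a finite union of compact pieces of smooth hypersurfaces {g = 0}. *)
definition piecewise_smooth_boundary :: "'a::euclidean_space set \<Rightarrow> bool" where
  "piecewise_smooth_boundary K \<longleftrightarrow>
     (\<exists>\<F>. finite \<F> \<and> frontier K = \<Union>\<F> \<and>
        (\<forall>F\<in>\<F>. compact F \<and>
           (\<exists>V g. open V \<and> F \<subseteq> V \<and> smooth_on V g \<and>
              (\<forall>x\<in>F. g x = 0) \<and> (\<forall>x\<in>V. frechet_derivative g (at x) \<noteq> (\<lambda>_. 0)))))"

global_interpretation fun_space: vector_space "\<lambda>(c::real) (f::'a \<Rightarrow> real) x. c * f x"
  by unfold_locales (auto simp: algebra_simps)

definition linear_form_on :: "('a \<Rightarrow> real) set \<Rightarrow> (('a \<Rightarrow> real) \<Rightarrow> real) \<Rightarrow> bool" where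
  "linear_form_on V L \<longleftrightarrow>
     (\<forall>f\<in>V. \<forall>g\<in>V. L (\<lambda>x. f x + g x) = L f + L g) \<and> (\<forall>c. \<forall>f\<in>V. L (\<lambda>x. c * f x) = c * L f)"

(* A linear form on V is represented by its extension by 0 to all functions. *)
definition dual_space :: "('a \<Rightarrow> real) set \<Rightarrow> (('a \<Rightarrow> real) \<Rightarrow> real) set" where
  "dual_space V = {L. linear_form_on V L \<and> (\<forall>f. f \<notin> V \<longrightarrow> L f = 0)}"

definition restrict_form ::
  "('a \<Rightarrow> real) set \<Rightarrow> (('a \<Rightarrow> real) \<Rightarrow> real) \<Rightarrow> ('a \<Rightarrow> real) \<Rightarrow> real" where
  "restrict_form V L = (\<lambda>f. if f \<in> V then L f else 0)"

definition basis_of_dual :: "('a \<Rightarrow> real) set \<Rightarrow> (('a \<Rightarrow> real) \<Rightarrow> real) set \<Rightarrow> bool" where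
  "basis_of_dual V \<N> \<longleftrightarrow>
     inj_on (restrict_form V) \<N> \<and>
     fun_space.independent (restrict_form V ` \<N>) \<and>
     fun_space.span (restrict_form V ` \<N>) = dual_space V"

(* A polynomial is determined by its values on K, as K has nonempty interior; hence P is given as a
   space of polynomial functions on the whole space. Nodal variables act on C^infinity(K), so they
   only see the values of a function on K. *)
definition finite_element ::
  "'a::euclidean_space set \<Rightarrow> ('a \<Rightarrow> real) set \<Rightarrow> (('a \<Rightarrow> real) \<Rightarrow> real) set \<Rightarrow> bool" where
  "finite_element K P \<N> \<longleftrightarrow>
     compact K \<and> connected K \<and> interior K \<noteq> {} \<and> piecewise_smooth_boundary K \<and>
     fun_space.subspace P \<and> (\<exists>B. finite B \<and> fun_space.span B = P) \<and>
     (\<forall>p\<in>P. real_polynomial_function p) \<and>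
     finite \<N> \<and>
     (\<forall>\<nu>\<in>\<N>. linear_form_on (Cinf K) \<nu> \<and>
        (\<forall>f\<in>Cinf K. \<forall>g\<in>Cinf K. (\<forall>x\<in>K. f x = g x) \<longrightarrow> \<nu> f = \<nu> g)) \<and>
     basis_of_dual P \<N>"

(* Existence and uniqueness of the interpolant follow from basis_of_dual, and so does linearity. *)
definition nodal_interpolation ::
  "'a::euclidean_space set \<Rightarrow> ('a \<Rightarrow> real) set \<Rightarrow> (('a \<Rightarrow> real) \<Rightarrow> real) set \<Rightarrow>
     (('a \<Rightarrow> real) \<Rightarrow> 'a \<Rightarrow> real) \<Rightarrow> bool" where
  "nodal_interpolation K P \<N> Pi_K \<longleftrightarrow>
     (\<forall>\<zeta>\<in>Cinf K. Pi_K \<zeta> \<in> P \<and> (\<forall>\<nu>\<in>\<N>. \<nu> (Pi_K \<zeta>) = \<nu> \<zeta>))"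

end

theory Submission
  imports Defs "HOL-Computational_Algebra.Polynomial"
begin

text \<open>
  Let \<open>c\<close> be the mean of \<open>\<omega>\<close> over \<open>K\<close>, \<open>h\<close> the diameter of \<open>K\<close> and \<open>\<eta> = \<omega>\<^sup>n - c\<^sup>n\<close>. Since \<open>\<Pi>\<close> reproduces
  \<open>c\<^sup>n chi\<close>, the interpolation error of \<open>\<omega>\<^sup>n chi\<close> is that of \<open>\<eta> chi\<close>, and it is controlled by the
  derivatives of \<open>\<eta> chi\<close> of order \<open>k + 1\<close>. In the Leibniz formula, the term with all derivatives on \<open>chi\<close>
  carries the factor \<open>\<eta> = O(h/d)\<close>, and an inverse estimate turns \<open>h\<close> into one derivative less. Inverse
  estimates also remove the orders between \<open>m + 1\<close> and \<open>k\<close>, which gives the first inequality.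

  For the second one, put \<open>\<rho> \<approx> \<bar>c\<bar> + h/d\<close>, which dominates \<open>\<bar>\<omega>\<bar>\<close> on \<open>K\<close>. The derivatives
  of order \<open>i\<close> of \<open>\<omega>\<^sup>n\<close> are
  \<open>O(d\<^sup>-\<^sup>i \<rho>\<^sup>n\<^sup>-\<^sup>i)\<close>, so for \<open>n \<ge> m + 1\<close> every \<open>d\<^sup>j\<close>-weighted derivative of order \<open>j\<close> of \<open>chi\<close> comes with a factor
  \<open>\<rho>\<^sup>j\<close>. The part \<open>(h/d)\<^sup>j\<close> of \<open>\<rho>\<^sup>j\<close> is absorbed by an inverse estimate down to order 0; for the part \<open>\<bar>c\<bar>\<^sup>j\<close> one writes
  \<open>c\<^sup>j chi = \<omega>\<^sup>j chi - (\<omega>\<^sup>j - c\<^sup>j) chi\<close>, where the last term only involves lower orders with the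
  same weights, and uses a discrete Gronwall argument.

  The functions involved are smooth, so the weak derivatives in the Sobolev seminorms have to be identified
  with classical ones: this is integration by parts together with the fundamental lemma of
  the calculus of variations.
\<close>

section \<open>Smooth functions and their partial derivatives\<close>

text \<open>At a successor \<open>Ck_on\<close> speaks only of differentiability and of the
  derivatives, so lower orders have to be recovered: differentiability gives continuity at the
  bottom, and the induction passes to the derivatives.\<close>

lemma Ck_on_SucD: "Ck_on (Suc k) S f \<Longrightarrow> Ck_on k S f"
proof (induction k arbitrary: f)
  case 0
  then show ?case
    by (auto intro!: continuous_at_imp_continuous_on differentiable_imp_continuous_within)
next
  case (Suc k)
  from Suc.prems have "Ck_on (Suc k) S (\<lambda>x. frechet_derivative f (at x) v)" for v
    by simp
  then have "Ck_on k S (\<lambda>x. frechet_derivative f (at x) v)" for v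
    by (rule Suc.IH)
  with Suc.prems show ?case by auto
qed

lemma frechet_derivative_at_const [simp]: "frechet_derivative (\<lambda>x. c) (at x) = (\<lambda>_. 0)"
  by (rule frechet_derivative_at[symmetric]) (auto intro!: derivative_eq_intros)

lemma Ck_on_const: "Ck_on k S (\<lambda>x. c)"
  by (induction k arbitrary: c) auto

lemma frechet_derivative_at_add:
  assumes "f differentiable (at x)" "g differentiable (at x)"
  shows "frechet_derivative (\<lambda>x. f x + g x) (at x) =
           (\<lambda>v. frechet_derivative f (at x) v + frechet_derivative g (at x) v)"
  using assms
  by (intro frechet_derivative_at[symmetric] has_derivative_add) (auto simp: frechet_derivative_works)

lemma frechet_derivative_at_mult:
  fixes f g :: "'a::real_normed_vector \<Rightarrow> real"
  assumes "f differentiable (at x)" "g differentiable (at x)"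
  shows "frechet_derivative (\<lambda>x. f x * g x) (at x) =
           (\<lambda>v. f x * frechet_derivative g (at x) v + frechet_derivative f (at x) v * g x)"
  using assms
  by (intro frechet_derivative_at[symmetric] has_derivative_mult) (auto simp: frechet_derivative_works)

lemma Ck_on_add:
  assumes "Ck_on k UNIV f" "Ck_on k UNIV g"
  shows "Ck_on k UNIV (\<lambda>x. f x + g x)"
  using assms
proof (induction k arbitrary: f g)
  case 0
  then show ?case by (auto intro: continuous_on_add)
next
  case (Suc k)
  then show ?case by (auto simp: frechet_derivative_at_add)
qed

lemma Ck_on_mult:
  assumes "Ck_on k UNIV f" "Ck_on k UNIV g"
  shows "Ck_on k UNIV (\<lambda>x. f x * g x)"
  using assms
proof (induction k arbitrary: f g)
  case 0
  then show ?case by (auto intro: continuous_on_mult)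
next
  case (Suc k)
  then have "Ck_on k UNIV f" "Ck_on k UNIV g"
    by (blast dest: Ck_on_SucD)+
  with Suc show ?case
    by (auto simp: frechet_derivative_at_mult intro!: Ck_on_add)
qed

lemma Ck_on_bounded_linear: "bounded_linear f \<Longrightarrow> Ck_on k UNIV f"
proof (cases k)
  case 0
  then show "bounded_linear f \<Longrightarrow> ?thesis"
    by (simp add: linear_continuous_on)
next
  case (Suc j)
  assume f: "bounded_linear f"
  then have "(f has_derivative f) (at x)" for x
    by (rule bounded_linear_imp_has_derivative)
  then have "f differentiable (at x)" "frechet_derivative f (at x) = f" for x
    by (auto simp: differentiable_def frechet_derivative_at[symmetric])
  with Suc show ?thesis by (simp add: Ck_on_const)
qed

lemma smooth_on_const: "smooth_on S (\<lambda>x. c)"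
  by (simp add: smooth_on_def Ck_on_const)

lemma smooth_on_add: "smooth_on UNIV f \<Longrightarrow> smooth_on UNIV g \<Longrightarrow> smooth_on UNIV (\<lambda>x. f x + g x)"
  by (simp add: smooth_on_def Ck_on_add)

lemma smooth_on_mult: "smooth_on UNIV f \<Longrightarrow> smooth_on UNIV g \<Longrightarrow> smooth_on UNIV (\<lambda>x. f x * g x)"
  by (simp add: smooth_on_def Ck_on_mult)

lemma smooth_on_cmult: "smooth_on UNIV f \<Longrightarrow> smooth_on UNIV (\<lambda>x. c * f x)"
  by (intro smooth_on_mult smooth_on_const)

lemma smooth_on_diff:
  assumes "smooth_on UNIV f" "smooth_on UNIV g"
  shows "smooth_on UNIV (\<lambda>x. f x - g x)"
  using smooth_on_add[OF assms(1) smooth_on_cmult[OF assms(2), of "-1"]] by simp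

lemma smooth_on_power: "smooth_on UNIV f \<Longrightarrow> smooth_on UNIV (\<lambda>x. f x ^ n)"
  by (induction n) (auto intro: smooth_on_const smooth_on_mult)

lemma smooth_on_prod:
  "(\<And>i. i \<in> I \<Longrightarrow> smooth_on UNIV (f i)) \<Longrightarrow> smooth_on UNIV (\<lambda>x. \<Prod>i\<in>I. f i x)"
  by (induction I rule: infinite_finite_induct) (auto intro: smooth_on_const smooth_on_mult)

lemma smooth_on_real_polynomial_function:
  "real_polynomial_function p \<Longrightarrow> smooth_on UNIV p"
proof (induction rule: real_polynomial_function.induct)
  case (linear f)
  then show ?case by (simp add: smooth_on_def Ck_on_bounded_linear)
qed (auto intro: smooth_on_const smooth_on_add smooth_on_mult)

lemma smooth_on_differentiable: "smooth_on S f \<Longrightarrow> x \<in> S \<Longrightarrow> f differentiable (at x)"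
  unfolding smooth_on_def using Ck_on.simps(2) by blast

lemma smooth_on_continuous_on: "smooth_on S f \<Longrightarrow> continuous_on S f"
  unfolding smooth_on_def using Ck_on.simps(1) by blast

lemma smooth_on_frechet_derivative:
  "smooth_on S f \<Longrightarrow> smooth_on S (\<lambda>x. frechet_derivative f (at x) v)"
  unfolding smooth_on_def using Ck_on.simps(2) by blast

text \<open>Serves families that differentiation maps into themselves, such as
  \<open>flat_exp\<close> with varying polynomial, without a formula for derivatives of order
  k.\<close>

lemma smooth_on_coinduct:
  assumes f: "f \<in> F"
    and diff: "\<And>g x. g \<in> F \<Longrightarrow> g differentiable (at x)"
    and closed: "\<And>g v. g \<in> F \<Longrightarrow> (\<lambda>x. frechet_derivative g (at x) v) \<in> F"
  shows "smooth_on UNIV f"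
proof -
  have "Ck_on k UNIV g" if "g \<in> F" for k g
    using that
  proof (induction k arbitrary: g)
    case 0
    then show ?case
      using diff by (auto intro!: continuous_at_imp_continuous_on differentiable_imp_continuous_within)
  next
    case (Suc k)
    then show ?case using diff closed by auto
  qed
  with f show ?thesis by (simp add: smooth_on_def)
qed

text \<open>Names the single step of \<open>pderivs\<close>. Later proofs switch
  \<open>pderivs.simps(2)\<close> off, because it would unfold the step to
  \<open>frechet_derivative\<close>.\<close>

definition pd :: "'n \<Rightarrow> (real ^ 'n::finite \<Rightarrow> real) \<Rightarrow> real ^ 'n \<Rightarrow> real" where
  "pd i f = (\<lambda>x. frechet_derivative f (at x) (axis i 1))"

lemma pderivs_Cons: "pderivs (i # xs) f = pderivs xs (pd i f)"
  by (simp add: pd_def)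

lemma pderivs_fold: "pderivs xs f = fold pd xs f"
  by (induction xs arbitrary: f) (simp_all add: pd_def)

lemma smooth_on_pd: "smooth_on UNIV f \<Longrightarrow> smooth_on UNIV (pd i f)"
  unfolding pd_def by (rule smooth_on_frechet_derivative)

lemma smooth_on_pderivs: "smooth_on UNIV f \<Longrightarrow> smooth_on UNIV (pderivs xs f)"
  by (induction xs arbitrary: f) (auto simp: pderivs_Cons smooth_on_pd simp del: pderivs.simps(2))

lemma smooth_on_mderiv: "smooth_on UNIV f \<Longrightarrow> smooth_on UNIV (mderiv \<alpha> f)"
  unfolding mderiv_def by (rule smooth_on_pderivs)

lemma pd_add:
  assumes "smooth_on UNIV f" "smooth_on UNIV g"
  shows "pd i (\<lambda>x. f x + g x) = (\<lambda>x. pd i f x + pd i g x)"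
  unfolding pd_def
  by (rule ext, subst frechet_derivative_at_add) (use assms in \<open>auto intro: smooth_on_differentiable\<close>)

lemma pd_mult:
  assumes "smooth_on UNIV f" "smooth_on UNIV g"
  shows "pd i (\<lambda>x. f x * g x) = (\<lambda>x. f x * pd i g x + pd i f x * g x)"
  unfolding pd_def
  by (rule ext, subst frechet_derivative_at_mult) (use assms in \<open>auto intro: smooth_on_differentiable\<close>)

lemma pd_const [simp]: "pd i (\<lambda>x. c) = (\<lambda>x. 0)"
  by (simp add: pd_def)

lemma pd_cmult: "smooth_on UNIV f \<Longrightarrow> pd i (\<lambda>x. c * f x) = (\<lambda>x. c * pd i f x)"
  by (subst pd_mult) (auto intro: smooth_on_const)

lemma pderivs_add:
  assumes "smooth_on UNIV f" "smooth_on UNIV g"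
  shows "pderivs xs (\<lambda>x. f x + g x) = (\<lambda>x. pderivs xs f x + pderivs xs g x)"
  using assms
  by (induction xs arbitrary: f g)
    (auto simp: pderivs_Cons pd_add smooth_on_pd simp del: pderivs.simps(2))

lemma pderivs_cmult:
  assumes "smooth_on UNIV f"
  shows "pderivs xs (\<lambda>x. c * f x) = (\<lambda>x. c * pderivs xs f x)"
  using assms
  by (induction xs arbitrary: f)
    (auto simp: pderivs_Cons pd_cmult smooth_on_pd simp del: pderivs.simps(2))

lemma pderivs_const: "xs \<noteq> [] \<Longrightarrow> pderivs xs (\<lambda>x. c) = (\<lambda>x. 0)"
proof (induction xs arbitrary: c)
  case (Cons i xs)
  then show ?case
    by (cases xs) (auto simp: pderivs_Cons simp del: pderivs.simps(2) intro: pderivs.simps(1))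
qed simp

section \<open>Symmetry of mixed partial derivatives\<close>

lemma DERIV_pd:
  assumes "smooth_on UNIV f"
  shows "((\<lambda>t. f (x + t *\<^sub>R axis i 1)) has_real_derivative pd i f (x + t *\<^sub>R axis i 1)) (at t)"
proof -
  let ?e = "axis i (1::real)"
  have f: "(f has_derivative frechet_derivative f (at (x + t *\<^sub>R ?e))) (at (x + t *\<^sub>R ?e))"
    using assms smooth_on_differentiable frechet_derivative_works by blast
  have "((\<lambda>t. x + t *\<^sub>R ?e) has_derivative (\<lambda>s. s *\<^sub>R ?e)) (at t)"
    by (auto intro!: derivative_eq_intros)
  from diff_chain_at[OF this f] show ?thesis
    unfolding has_field_derivative_def pd_def o_def
    by (elim has_derivative_eq_rhs)
      (auto simp: fun_eq_iff linear_cmul[OF has_derivative_linear[OF f]])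
qed

text \<open>Two applications of the mean value theorem to the second difference
  \<open>f(x + s e\<^sub>i + s e\<^sub>j) - f(x + s e\<^sub>i) - f(x + s e\<^sub>j) + f(x)\<close>; it is symmetric in i and j.\<close>

lemma second_difference_mean_value:
  assumes f: "smooth_on UNIV f" and s: "s > 0"
  shows "\<exists>a b. 0 < a \<and> a < s \<and> 0 < b \<and> b < s \<and>
    f (x + s *\<^sub>R axis i 1 + s *\<^sub>R axis j 1) - f (x + s *\<^sub>R axis i 1) - f (x + s *\<^sub>R axis j 1) + f x =
    s * s * pd j (pd i f) (x + a *\<^sub>R axis i 1 + b *\<^sub>R axis j 1)"
proof -
  let ?u = "axis i (1::real)" and ?v = "axis j (1::real)"
  define g where "g t = f (x + s *\<^sub>R ?v + t *\<^sub>R ?u) - f (x + t *\<^sub>R ?u)" for t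
  have "DERIV g t :> pd i f (x + s *\<^sub>R ?v + t *\<^sub>R ?u) - pd i f (x + t *\<^sub>R ?u)" for t
    unfolding g_def by (intro DERIV_diff DERIV_pd f)
  from MVT2[OF s this] obtain a where a: "0 < a" "a < s"
    "g s - g 0 = s * (pd i f (x + s *\<^sub>R ?v + a *\<^sub>R ?u) - pd i f (x + a *\<^sub>R ?u))"
    by auto
  have "DERIV (\<lambda>t. pd i f (x + a *\<^sub>R ?u + t *\<^sub>R ?v)) t :> pd j (pd i f) (x + a *\<^sub>R ?u + t *\<^sub>R ?v)" for t
    by (intro DERIV_pd smooth_on_pd f)
  from MVT2[OF s this] obtain b where b: "0 < b" "b < s"
    "pd i f (x + a *\<^sub>R ?u + s *\<^sub>R ?v) - pd i f (x + a *\<^sub>R ?u) = s * pd j (pd i f) (x + a *\<^sub>R ?u + b *\<^sub>R ?v)"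
    by auto
  have "g s - g 0 = s * (s * pd j (pd i f) (x + a *\<^sub>R ?u + b *\<^sub>R ?v))"
    using a(3) b(3) by (simp add: algebra_simps)
  with a(1,2) b(1,2) show ?thesis
    unfolding g_def by (intro exI[of _ a] exI[of _ b]) (simp add: algebra_simps)
qed

text \<open>The intermediate point of the mean value formula is within 2s of x, hence the
  restriction s < r / 2; continuity of the second derivative then gives the limit.\<close>

lemma tendsto_second_difference:
  assumes f: "smooth_on UNIV f"
  shows "((\<lambda>s. (f (x + s *\<^sub>R axis i 1 + s *\<^sub>R axis j 1) - f (x + s *\<^sub>R axis i 1) - f (x + s *\<^sub>R axis j 1) + f x)
            / (s * s)) \<longlongrightarrow> pd j (pd i f) x) (at_right 0)"
    (is "(?D \<longlongrightarrow> ?l) _")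
proof (rule tendstoI)
  fix e :: real assume "e > 0"
  have "continuous (at x) (pd j (pd i f))"
    using smooth_on_continuous_on[OF smooth_on_pd[OF smooth_on_pd[OF f]]]
    by (simp add: continuous_on_eq_continuous_at)
  with \<open>e > 0\<close> obtain r where r: "r > 0"
    "\<And>y. dist y x < r \<Longrightarrow> dist (pd j (pd i f) y) ?l < e"
    unfolding continuous_at_eps_delta by blast
  have "dist (?D s) ?l < e" if s: "0 < s" "s < r / 2" for s
  proof -
    obtain a b where ab: "0 < a" "a < s" "0 < b" "b < s" and
      eq: "f (x + s *\<^sub>R axis i 1 + s *\<^sub>R axis j 1) - f (x + s *\<^sub>R axis i 1) - f (x + s *\<^sub>R axis j 1) + f x =
        s * s * pd j (pd i f) (x + a *\<^sub>R axis i 1 + b *\<^sub>R axis j 1)"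
      using second_difference_mean_value[OF f s(1)] by blast
    have "norm (a *\<^sub>R axis i (1::real) + b *\<^sub>R axis j 1) \<le> a + b"
      using ab by (intro norm_triangle_le) (simp add: norm_axis_1)
    also have "\<dots> < r" using ab s by simp
    finally have "dist (x + a *\<^sub>R axis i 1 + b *\<^sub>R axis j 1) x < r"
      by (simp add: dist_norm add.assoc)
    from r(2)[OF this] show ?thesis using s by (simp add: eq)
  qed
  then show "\<forall>\<^sub>F s in at_right 0. dist (?D s) ?l < e"
    unfolding eventually_at_right_field using \<open>r > 0\<close> by (intro exI[of _ "r / 2"]) auto
qed

text \<open>Both orders are limits of one and the same difference quotient, which is symmetric in i
  and j.\<close>

lemma pd_commute:
  assumes f: "smooth_on UNIV f"
  shows "pd i (pd j f) = pd j (pd i f)"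
proof
  fix x
  have "((\<lambda>s. (f (x + s *\<^sub>R axis i 1 + s *\<^sub>R axis j 1) - f (x + s *\<^sub>R axis i 1) - f (x + s *\<^sub>R axis j 1) + f x)
            / (s * s)) \<longlongrightarrow> pd i (pd j f) x) (at_right 0)"
    using tendsto_second_difference[OF f, of x j i] by (simp add: algebra_simps)
  from tendsto_unique[OF _ this tendsto_second_difference[OF f, of x i j]]
  show "pd i (pd j f) x = pd j (pd i f) x" by simp
qed

lemma pderivs_mset_cong:
  assumes "mset xs = mset ys" "smooth_on UNIV f"
  shows "pderivs xs f = pderivs ys f"
  unfolding pderivs_fold
  by (rule fold_permuted_eq[where P = "smooth_on UNIV"])
    (use assms in \<open>auto intro: smooth_on_pd pd_commute\<close>)

section \<open>Multi-indices and lists of directions\<close>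

lemma ex_list_with_counts: "\<exists>xs. \<forall>i::'n::finite. count_list xs i = \<alpha> i"
proof -
  obtain xs where "mset xs = Abs_multiset \<alpha>"
    using ex_mset by blast
  then have "count_list xs i = \<alpha> i" for i
    by (simp add: count_mset[symmetric] Abs_multiset_inverse)
  then show ?thesis by blast
qed

lemma length_eq_sum_count_list: "length xs = (\<Sum>i\<in>UNIV. count_list xs (i::'n::finite))"
  using sum_count_set[of xs UNIV] by simp

text \<open>The list depends on \<alpha> alone, so that one list serves a function and its test
  function together in the integration by parts.\<close>

lemma mderiv_eq_pderivs:
  obtains xs where "length xs = sum \<alpha> UNIV" "\<And>f. mderiv \<alpha> f = pderivs xs f"
proof -
  let ?xs = "SOME xs. \<forall>i. count_list xs i = \<alpha> i"
  have "\<forall>i. count_list ?xs i = \<alpha> i"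
    using someI_ex[OF ex_list_with_counts] .
  then show ?thesis
    using that[of ?xs] by (simp add: mderiv_def length_eq_sum_count_list)
qed

lemma pderivs_eq_mderiv:
  assumes "smooth_on UNIV f"
  shows "pderivs xs f = mderiv (count_list xs) f"
proof -
  let ?ys = "SOME ys. \<forall>i. count_list ys i = count_list xs i"
  have "\<forall>i. count_list ?ys i = count_list xs i"
    using someI_ex[OF ex_list_with_counts] .
  then have "mset xs = mset ?ys"
    by (intro multiset_eqI) (simp add: count_mset)
  then show ?thesis
    unfolding mderiv_def using assms by (rule pderivs_mset_cong)
qed

section \<open>Bump functions supported on boxes\<close>

text \<open>For c > 0 the functions P(1/t) exp(-c/t), extended by 0 to t <= 0, form a class closed
  under differentiation; P = 1 is the classical flat function.\<close>

definition flat_exp :: "real \<Rightarrow> real poly \<Rightarrow> real \<Rightarrow> real" where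
  "flat_exp c P t = (if t > 0 then poly P (1 / t) * exp (- c / t) else 0)"

lemma tendsto_poly_mult_exp_at_top:
  fixes c :: real
  assumes "c > 0"
  shows "((\<lambda>y. poly Q y * exp (- c * y)) \<longlongrightarrow> 0) at_top"
proof -
  have "((\<lambda>y. \<Sum>i\<le>degree Q. coeff Q i * (y ^ i * exp (- c * y))) \<longlongrightarrow> 0) at_top"
  proof (intro tendsto_null_sum tendsto_mult_right_zero)
    fix i :: nat
    show "((\<lambda>y::real. y ^ i * exp (- c * y)) \<longlongrightarrow> 0) at_top"
    proof (rule Lim_transform_eventually)
      have "((\<lambda>y. (c * y) ^ i / exp (c * y)) \<longlongrightarrow> 0) at_top"
        by (intro filterlim_compose[OF tendsto_power_div_exp_0]
            filterlim_tendsto_pos_mult_at_top[OF tendsto_const assms filterlim_ident])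
      then show "((\<lambda>y. inverse (c ^ i) * ((c * y) ^ i / exp (c * y))) \<longlongrightarrow> 0) at_top"
        by (rule tendsto_mult_right_zero)
    qed (use assms in \<open>simp add: power_mult_distrib exp_minus field_simps\<close>)
  qed
  then show ?thesis
    by (simp add: poly_altdef sum_distrib_right mult.assoc)
qed

text \<open>For t > 0 the derivative of P(1/t) exp(-c/t) is t^(-2) (c P - P')(1/t) exp(-c/t), and
  t^(-2) is the polynomial \<open>[:0, 0, 1:]\<close> at 1/t. At 0 both one-sided difference
  quotients tend to 0.\<close>

lemma DERIV_flat_exp:
  assumes c: "c > 0"
  shows "(flat_exp c P has_real_derivative flat_exp c ([:0, 0, 1:] * (smult c P - pderiv P)) t) (at t)"
proof -
  consider "t > 0" | "t < 0" | "t = 0" by linarith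
  then show ?thesis
  proof cases
    case 1
    have "((\<lambda>t. poly P (1 / t) * exp (- c / t)) has_real_derivative
        flat_exp c ([:0, 0, 1:] * (smult c P - pderiv P)) t) (at t)"
    proof (rule DERIV_cong)
      have "((\<lambda>t. 1 / t) has_real_derivative - (1 / t ^ 2)) (at t)"
        using 1 by (auto intro!: derivative_eq_intros simp: power2_eq_square)
      from DERIV_chain2[OF poly_DERIV this, of P]
      have dP: "((\<lambda>t. poly P (1 / t)) has_real_derivative poly (pderiv P) (1 / t) * - (1 / t ^ 2)) (at t)" .
      have "((\<lambda>t. exp (- c / t)) has_real_derivative exp (- c / t) * (c / t ^ 2)) (at t)"
        using 1 by (auto intro!: derivative_eq_intros simp: power2_eq_square)
      from DERIV_mult[OF dP this]
      show "((\<lambda>t. poly P (1 / t) * exp (- c / t)) has_real_derivative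
        poly (pderiv P) (1 / t) * - (1 / t ^ 2) * exp (- c / t) +
        exp (- c / t) * (c / t ^ 2) * poly P (1 / t)) (at t)" .
    qed (use 1 in \<open>simp add: flat_exp_def algebra_simps power2_eq_square\<close>)
    moreover have "\<forall>\<^sub>F s in nhds t. poly P (1 / s) * exp (- c / s) = flat_exp c P s"
      using 1 by (intro eventually_nhds_in_open[of "{0<..}", THEN eventually_mono])
        (auto simp: flat_exp_def)
    ultimately show ?thesis
      by (subst DERIV_cong_ev[OF refl _ refl]) (auto elim: eventually_mono)
  next
    case 2
    have "((\<lambda>t. 0) has_real_derivative flat_exp c ([:0, 0, 1:] * (smult c P - pderiv P)) t) (at t)"
      using 2 by (simp add: flat_exp_def)
    moreover have "\<forall>\<^sub>F s in nhds t. 0 = flat_exp c P s"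
      using 2 by (intro eventually_nhds_in_open[of "{..<0}", THEN eventually_mono])
        (auto simp: flat_exp_def)
    ultimately show ?thesis
      by (subst DERIV_cong_ev[OF refl _ refl]) (auto elim: eventually_mono)
  next
    case 3
    have "((\<lambda>h. (flat_exp c P (0 + h) - flat_exp c P 0) / h) \<longlongrightarrow> 0) (at 0)"
    proof (rule filterlim_split_at)
      show "((\<lambda>h. (flat_exp c P (0 + h) - flat_exp c P 0) / h) \<longlongrightarrow> 0) (at_left 0)"
        by (rule tendsto_eventually) (auto simp: flat_exp_def eventually_at_filter)
      \<comment> \<open>On the right the quotient at 0 is P(1/h) exp(-c/h) / h. The factor 1/h
        multiplies P by its variable, which gives \<open>pCons 0 P\<close>.\<close>
      have "((\<lambda>h. poly (pCons 0 P) (inverse h) * exp (- c * inverse h)) \<longlongrightarrow> 0) (at_right 0)"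
        by (rule filterlim_compose[OF tendsto_poly_mult_exp_at_top[OF c] filterlim_inverse_at_top_right])
      then show "((\<lambda>h. (flat_exp c P (0 + h) - flat_exp c P 0) / h) \<longlongrightarrow> 0) (at_right 0)"
        by (rule Lim_transform_eventually)
          (auto simp: flat_exp_def eventually_at_filter field_simps)
    qed
    with 3 show ?thesis
      by (simp add: DERIV_def flat_exp_def)
  qed
qed

text \<open>The chain rule factor \<open>s * v $ i\<close> is absorbed into the polynomial, so the
  family stays closed. The slope \<open>s\<close> is 1 or -1 for the two opposite faces of a
  box.\<close>

lemma smooth_on_flat_exp:
  fixes i :: "'n::finite"
  assumes c: "c > 0"
  shows "smooth_on UNIV (\<lambda>x::real^'n. flat_exp c P (s * x $ i - a))"
proof (rule smooth_on_coinduct)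
  let ?F = "range (\<lambda>P (x::real^'n). flat_exp c P (s * x $ i - a))"
  show "(\<lambda>x. flat_exp c P (s * x $ i - a)) \<in> ?F" by blast
  fix g assume "g \<in> ?F"
  then obtain P where g: "g = (\<lambda>x. flat_exp c P (s * x $ i - a))" by blast
  define Q where "Q = [:0, 0, 1:] * (smult c P - pderiv P)"
  have D: "(g has_derivative (\<lambda>v. flat_exp c Q (s * x $ i - a) * (s * v $ i))) (at x)" for x
  proof -
    have "((\<lambda>x::real^'n. s * x $ i - a) has_derivative (\<lambda>v. s * v $ i)) (at x)"
      by (auto intro!: derivative_eq_intros bounded_linear.has_derivative[OF bounded_linear_vec_nth])
    from diff_chain_at[OF this DERIV_flat_exp[OF c, of P "s * x $ i - a",
          unfolded has_field_derivative_def, folded Q_def]]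
    show ?thesis by (simp add: o_def g)
  qed
  show "g differentiable (at x)" for x
    using D by (auto simp: differentiable_def)
  show "(\<lambda>x. frechet_derivative g (at x) v) \<in> ?F" for v
  proof -
    have "(\<lambda>x. frechet_derivative g (at x) v) =
        (\<lambda>x. flat_exp c (smult (s * v $ i) Q) (s * x $ i - a))"
      by (auto simp: frechet_derivative_at[OF D, symmetric] flat_exp_def)
    then show ?thesis by blast
  qed
qed

text \<open>The exponential parameter tends to 0 as m grows, so each factor tends to 1 wherever it
  is positive. The bumps thus converge pointwise to the indicator of the open box while staying
  between 0 and 1.\<close>

definition box_bump :: "nat \<Rightarrow> real ^ 'n::finite \<Rightarrow> real ^ 'n \<Rightarrow> real ^ 'n \<Rightarrow> real" where
  "box_bump m a b x = (\<Prod>i\<in>UNIV. flat_exp (1 / real (Suc m)) 1 (x $ i - a $ i) *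
                                   flat_exp (1 / real (Suc m)) 1 (b $ i - x $ i))"

lemma smooth_on_box_bump: "smooth_on UNIV (box_bump m a b)"
proof -
  have "smooth_on UNIV (\<lambda>x::real^'a. flat_exp (1 / real (Suc m)) 1 (1 * x $ i - a $ i) *
          flat_exp (1 / real (Suc m)) 1 (- 1 * x $ i - (- (b $ i))))" for i
    by (intro smooth_on_mult smooth_on_flat_exp) auto
  then show ?thesis
    unfolding box_bump_def[abs_def] by (intro smooth_on_prod) simp
qed

lemma flat_exp_one_bounds: "0 \<le> flat_exp (1 / real (Suc m)) 1 t" "flat_exp (1 / real (Suc m)) 1 t \<le> 1"
  by (auto simp: flat_exp_def)

lemma box_bump_bounds: "0 \<le> box_bump m a b x" "box_bump m a b x \<le> 1"
  unfolding box_bump_def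
  by (intro prod_nonneg prod_le_1 mult_le_one flat_exp_one_bounds mult_nonneg_nonneg ballI conjI)+

lemma box_bump_nonzero_iff: "box_bump m a b x \<noteq> 0 \<longleftrightarrow> x \<in> box a b"
  by (auto simp: box_bump_def flat_exp_def mem_box_cart)

lemma box_bump_test_function:
  assumes "cbox a b \<subseteq> U"
  shows "box_bump m a b \<in> test_functions U"
proof -
  have "closure {x. box_bump m a b x \<noteq> 0} \<subseteq> cbox a b"
    by (intro closure_minimal) (auto simp: box_bump_nonzero_iff intro: box_subset_cbox[THEN subsetD])
  then show ?thesis
    using assms compact_cbox smooth_on_box_bump
    by (auto simp: test_functions_def intro: compact_closure[THEN iffD2] bounded_subset[OF bounded_cbox]
        dest: closure_subset[THEN order_trans])
qed

lemma tendsto_box_bump: "(\<lambda>m. box_bump m a b x) \<longlonglongrightarrow> indicator (box a b) x"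
proof (cases "x \<in> box a b")
  case True
  have *: "(\<lambda>m. flat_exp (1 / real (Suc m)) 1 t) \<longlonglongrightarrow> 1" if "t > 0" for t
  proof -
    have "(\<lambda>m. exp (- (1 / real (Suc m)) / t)) \<longlonglongrightarrow> exp (- 0 / t)"
      using that by (intro tendsto_intros LIMSEQ_Suc[OF lim_1_over_n]) auto
    then show ?thesis using that by (simp add: flat_exp_def)
  qed
  have "(\<lambda>m. box_bump m a b x) \<longlonglongrightarrow> (\<Prod>i\<in>(UNIV::'a set). 1 * 1)"
    unfolding box_bump_def using True
    by (intro tendsto_prod tendsto_mult *) (auto simp: mem_box_cart)
  with True show ?thesis by simp
next
  case False
  then have "box_bump m a b x = 0" for m
    using box_bump_nonzero_iff by blast
  with False show ?thesis by simp
qed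

section \<open>Weak derivatives of smooth functions\<close>

lemma test_functionsD:
  assumes "\<phi> \<in> test_functions U"
  shows "smooth_on UNIV \<phi>" "compact (closure {x. \<phi> x \<noteq> 0})" "x \<notin> U \<Longrightarrow> \<phi> x = 0"
  using assms closure_subset[of "{x. \<phi> x \<noteq> 0}"] by (auto simp: test_functions_def)

lemma pd_nonzero_in_closure:
  assumes "x \<notin> closure {x. f x \<noteq> 0}"
  shows "pd i f x = 0"
proof -
  have "(f has_derivative (\<lambda>_. 0)) (at x)"
    by (rule has_derivative_transform_within_open[of "\<lambda>_. 0" _ x UNIV "- closure {x. f x \<noteq> 0}"])
      (use assms closure_subset[of "{x. f x \<noteq> 0}"] in auto)
  then show ?thesis
    by (simp add: pd_def frechet_derivative_at[symmetric])
qed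

lemma test_functions_supportI:
  assumes "smooth_on UNIV f" "\<phi> \<in> test_functions U"
    and sub: "closure {x. f x \<noteq> 0} \<subseteq> closure {x. \<phi> x \<noteq> 0}"
  shows "f \<in> test_functions U"
proof -
  have "compact (closure {x. \<phi> x \<noteq> 0} \<inter> closure {x. f x \<noteq> 0})"
    by (intro compact_Int_closed test_functionsD(2)[OF assms(2)] closed_closure)
  then have "compact (closure {x. f x \<noteq> 0})"
    using sub by (simp only: inf.absorb2)
  moreover have "closure {x. f x \<noteq> 0} \<subseteq> U"
    using sub assms(2) unfolding test_functions_def by blast
  ultimately show ?thesis
    using assms(1) unfolding test_functions_def by blast
qed

lemma test_functions_mono: "U \<subseteq> V \<Longrightarrow> test_functions U \<subseteq> test_functions V"
  unfolding test_functions_def by blast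

lemma pd_test_function:
  assumes "\<phi> \<in> test_functions U"
  shows "pd i \<phi> \<in> test_functions U"
proof -
  have "closure {x. pd i \<phi> x \<noteq> 0} \<subseteq> closure {x. \<phi> x \<noteq> 0}"
    using pd_nonzero_in_closure by (intro closure_minimal) auto
  then show ?thesis
    by (intro test_functions_supportI[OF _ assms] smooth_on_pd test_functionsD(1)[OF assms])
qed

lemma integrable_continuous_compact_support:
  fixes f :: "'a::euclidean_space \<Rightarrow> real"
  assumes "continuous_on UNIV f" "compact S" "\<And>x. x \<notin> S \<Longrightarrow> f x = 0"
  shows "integrable lborel f"
proof -
  have "integrable lborel (\<lambda>x. indicator S x *\<^sub>R f x)"
    by (rule borel_integrable_compact) (use assms in \<open>auto intro: continuous_on_subset\<close>)
  also have "(\<lambda>x. indicator S x *\<^sub>R f x) = f"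
    using assms(3) by (force simp: indicator_def)
  finally show ?thesis .
qed

text \<open>Translation invariance annihilates the integral of every difference quotient.\<close>

lemma integral_pd_eq_0:
  assumes F: "F \<in> test_functions UNIV"
  shows "(LINT x|lborel. pd i F x) = 0"
proof -
  note sF = test_functionsD(1)[OF F]
  note cF = smooth_on_continuous_on[OF sF]
  obtain R where R: "closure {x. F x \<noteq> 0} \<subseteq> cball 0 R"
    using compact_imp_bounded[OF test_functionsD(2)[OF F]] unfolding bounded_iff by fastforce
  have F0: "F x = 0" if "norm x > R" for x
    using R closure_subset[of "{x. F x \<noteq> 0}"] that by fastforce
  have p0: "pd i F x = 0" if "norm x > R" for x
    using R that by (intro pd_nonzero_in_closure) auto
  have "bounded (pd i F ` cball 0 R)"
    by (intro compact_imp_bounded compact_continuous_image compact_cball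
        continuous_on_subset[OF smooth_on_continuous_on[OF smooth_on_pd[OF sF]]]) auto
  then obtain B where B: "B > 0" "\<And>x. x \<in> cball 0 R \<Longrightarrow> norm (pd i F x) \<le> B"
    by (auto simp: bounded_pos)
  then have B': "norm (pd i F x) \<le> B" for x
    using p0[of x] by (cases "norm x > R") auto
  define t where "t n = 1 / real (Suc n)" for n
  have t: "0 < t n" "t n \<le> 1" for n by (auto simp: t_def)
  define D where "D n x = (F (x + t n *\<^sub>R axis i 1) - F x) / t n" for n x
  have int: "integrable lborel F"
    by (rule integrable_continuous_compact_support[OF cF, of "cball 0 R"]) (auto intro: F0)
  have int_shift: "integrable lborel (\<lambda>x. F (x + c))" and
       eq_shift: "(LINT x|lborel. F (x + c)) = (LINT x|lborel. F x)" for c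
  proof -
    have F_meas: "F \<in> borel_measurable borel"
      using cF by (simp add: borel_measurable_continuous_onI)
    have "integrable (distr lborel borel ((+) c)) F"
      using int by (simp add: lborel_distr_plus)
    then show "integrable lborel (\<lambda>x. F (x + c))"
      using F_meas by (subst (asm) integrable_distr_eq) (auto simp: add.commute)
    have "(LINT x|lborel. F x) = (LINT x|distr lborel borel ((+) c). F x)"
      by (simp add: lborel_distr_plus)
    also have "\<dots> = (LINT x|lborel. F (x + c))"
      using F_meas by (subst integral_distr) (auto simp: add.commute)
    finally show "(LINT x|lborel. F (x + c)) = (LINT x|lborel. F x)" by simp
  qed
  have D0: "(LINT x|lborel. D n x) = 0" for n
    using int_shift[of "t n *\<^sub>R axis i 1"] int eq_shift[of "t n *\<^sub>R axis i 1"]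
    by (simp add: D_def)
  have "(\<lambda>n. LINT x|lborel. D n x) \<longlonglongrightarrow> (LINT x|lborel. pd i F x)"
  proof (rule integral_dominated_convergence)
    show "pd i F \<in> borel_measurable lborel"
      using smooth_on_continuous_on[OF smooth_on_pd[OF sF]] by (simp add: borel_measurable_continuous_onI)
    show "D n \<in> borel_measurable lborel" for n
    proof -
      have "continuous_on UNIV (D n)"
        unfolding D_def using t(1)[of n]
        by (intro continuous_on_divide continuous_on_diff cF continuous_on_const
            continuous_on_compose2[OF cF continuous_on_add[OF continuous_on_id continuous_on_const]]) auto
      then show ?thesis by (simp add: borel_measurable_continuous_onI)
    qed
    \<comment> \<open>The steps \<open>t n\<close> are at most 1, so \<open>D n\<close> vanishes
      outside the ball of radius R + 1; inside it the mean value theorem makes \<open>D n x\<close>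
      a value of \<open>pd i F\<close>, which is bounded by B everywhere.\<close>
    show "integrable lborel (\<lambda>x::real^'a. indicator (cball 0 (R + 1)) x *\<^sub>R B)"
      by (rule borel_integrable_compact) auto
    show "AE x in lborel. norm (D n x) \<le> indicator (cball 0 (R + 1)) x *\<^sub>R B" for n
    proof (rule AE_I2)
      fix x :: "real^'a"
      show "norm (D n x) \<le> indicator (cball 0 (R + 1)) x *\<^sub>R B"
      proof (cases "norm x \<le> R + 1")
        case True
        obtain s where "F (x + t n *\<^sub>R axis i 1) - F (x + 0 *\<^sub>R axis i 1)
            = (t n - 0) * pd i F (x + s *\<^sub>R axis i 1)"
          using MVT2[of 0 "t n" "\<lambda>s. F (x + s *\<^sub>R axis i 1)" "\<lambda>s. pd i F (x + s *\<^sub>R axis i 1)",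
              OF t(1) DERIV_pd[OF sF]] by blast
        then have "D n x = pd i F (x + s *\<^sub>R axis i 1)"
          using t(1)[of n] by (simp add: D_def)
        with True B' show ?thesis by simp
      next
        case False
        have "norm x \<le> norm (x + t n *\<^sub>R axis i 1) + norm (t n *\<^sub>R axis i (1::real))"
          using norm_triangle_ineq4[of "x + t n *\<^sub>R axis i 1" "t n *\<^sub>R axis i 1"] by simp
        also have "norm (t n *\<^sub>R axis i (1::real)) \<le> 1"
          using t[of n] by (simp add: norm_axis_1)
        finally have "norm (x + t n *\<^sub>R axis i 1) > R" using False by simp
        with False show ?thesis by (simp add: D_def F0)
      qed
    qed
    show "AE x in lborel. (\<lambda>n. D n x) \<longlonglongrightarrow> pd i F x"
    proof (rule AE_I2)
      fix x :: "real^'a"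
      have "((\<lambda>h. (F (x + (0 + h) *\<^sub>R axis i 1) - F (x + 0 *\<^sub>R axis i 1)) / h)
          \<longlongrightarrow> pd i F (x + 0 *\<^sub>R axis i 1)) (at 0)"
        using DERIV_pd[OF sF, of x i 0] unfolding DERIV_def .
      moreover have "filterlim t (at 0) sequentially"
        unfolding t_def using t[unfolded t_def]
        by (intro filterlim_atI LIMSEQ_Suc[OF lim_1_over_n] always_eventually) auto
      ultimately show "(\<lambda>n. D n x) \<longlonglongrightarrow> pd i F x"
        unfolding D_def by (auto dest: filterlim_compose)
    qed
  qed
  with D0 show ?thesis
    by (simp add: LIMSEQ_const_iff)
qed

text \<open>A test function of U vanishes off U, so the integral over U becomes one over the whole
  space with respect to \<open>lborel\<close>, the setting of
  \<open>integral_pd_eq_0\<close>.\<close>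

lemma set_integral_test_function_eq:
  assumes f: "continuous_on UNIV f" and \<phi>: "\<phi> \<in> test_functions U"
  shows "integrable lborel (\<lambda>x. f x * \<phi> x)"
    and "(LINT x:U|lebesgue. f x * \<phi> x) = (LINT x|lborel. f x * \<phi> x)"
proof -
  have cont: "continuous_on UNIV (\<lambda>x. f x * \<phi> x)"
    by (intro continuous_on_mult f smooth_on_continuous_on test_functionsD(1)[OF \<phi>])
  then show "integrable lborel (\<lambda>x. f x * \<phi> x)"
    using closure_subset[of "{x. \<phi> x \<noteq> 0}"]
    by (intro integrable_continuous_compact_support[OF _ test_functionsD(2)[OF \<phi>]]) auto
  have "(LINT x:U|lebesgue. f x * \<phi> x) = (LINT x|lebesgue. f x * \<phi> x)"
    unfolding set_lebesgue_integral_def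
    by (rule Bochner_Integration.integral_cong) (auto simp: indicator_def test_functionsD(3)[OF \<phi>])
  also have "\<dots> = (LINT x|lborel. f x * \<phi> x)"
    using cont by (intro integral_completion) (simp add: borel_measurable_continuous_onI)
  finally show "(LINT x:U|lebesgue. f x * \<phi> x) = (LINT x|lborel. f x * \<phi> x)" .
qed

text \<open>The product of f and the test function is again a test function; its partial derivative
  integrates to 0, and the product rule splits that integral.\<close>

lemma integral_by_parts_pd:
  assumes f: "smooth_on UNIV f" and \<phi>: "\<phi> \<in> test_functions U"
  shows "(LINT x:U|lebesgue. f x * pd i \<phi> x) = - (LINT x:U|lebesgue. pd i f x * \<phi> x)"
proof -
  have "closure {x. f x * \<phi> x \<noteq> 0} \<subseteq> closure {x. \<phi> x \<noteq> 0}"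
    by (intro closure_mono) auto
  then have "(\<lambda>x. f x * \<phi> x) \<in> test_functions U"
    by (intro test_functions_supportI[OF _ \<phi>] smooth_on_mult f test_functionsD(1)[OF \<phi>])
  then have "(\<lambda>x. f x * \<phi> x) \<in> test_functions UNIV"
    using test_functions_mono[OF subset_UNIV] by blast
  from integral_pd_eq_0[OF this, of i]
  have "(LINT x|lborel. f x * pd i \<phi> x + pd i f x * \<phi> x) = 0"
    by (simp add: pd_mult[OF f test_functionsD(1)[OF \<phi>]])
  moreover note cont = smooth_on_continuous_on[OF f] smooth_on_continuous_on[OF smooth_on_pd[OF f]]
  ultimately show ?thesis
    using set_integral_test_function_eq[OF cont(1) pd_test_function[OF \<phi>], of i]
          set_integral_test_function_eq[OF cont(2) \<phi>]
    by simp
qed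

lemma pderivs_snoc:
  assumes "smooth_on UNIV f"
  shows "pd i (pderivs xs f) = pderivs (i # xs) f"
proof -
  have "pd i (pderivs xs f) = pderivs (xs @ [i]) f"
    by (simp add: pderivs_fold)
  also have "\<dots> = pderivs (i # xs) f"
    by (rule pderivs_mset_cong[OF _ assms]) simp
  finally show ?thesis .
qed

text \<open>The direction that acts first on the test function ends up acting last on f;
  \<open>pderivs_snoc\<close> reconciles the two orders.\<close>

lemma integral_by_parts_pderivs:
  assumes f: "smooth_on UNIV f" and "\<phi> \<in> test_functions U"
  shows "(LINT x:U|lebesgue. f x * pderivs xs \<phi> x) =
         (- 1) ^ length xs * (LINT x:U|lebesgue. pderivs xs f x * \<phi> x)"
  using assms(2)
proof (induction xs arbitrary: \<phi>)
  case (Cons i xs)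
  have "(LINT x:U|lebesgue. f x * pderivs (i # xs) \<phi> x) =
      (- 1) ^ length xs * (LINT x:U|lebesgue. pderivs xs f x * pd i \<phi> x)"
    unfolding pderivs_Cons by (rule Cons.IH[OF pd_test_function[OF Cons.prems]])
  then show ?case
    by (simp add: integral_by_parts_pd[OF smooth_on_pderivs[OF f] Cons.prems] pderivs_snoc[OF f]
        del: pderivs.simps(2))
qed simp

lemma locally_integrable_on_continuous:
  assumes "continuous_on UNIV f"
  shows "locally_integrable_on U f"
  unfolding locally_integrable_on_def
proof (intro allI impI, elim conjE)
  fix S :: "'a set" assume S: "compact S"
  then have "integrable lborel (\<lambda>x. indicator S x *\<^sub>R f x)"
    using assms by (intro borel_integrable_compact) (auto intro: continuous_on_subset)
  then show "set_integrable lebesgue S f"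
    unfolding set_integrable_def by (subst integrable_completion) auto
qed

lemma is_weak_deriv_mderiv:
  assumes f: "smooth_on UNIV f"
  shows "is_weak_deriv U \<alpha> f (mderiv \<alpha> f)"
proof -
  obtain xs where xs: "length xs = sum \<alpha> UNIV" "\<And>f. mderiv \<alpha> f = pderivs xs f"
    using mderiv_eq_pderivs by blast
  show ?thesis
    unfolding is_weak_deriv_def xs(2)
    by (auto simp: integral_by_parts_pderivs[OF f] xs(1)[symmetric]
        intro!: locally_integrable_on_continuous smooth_on_continuous_on f smooth_on_pderivs)
qed

section \<open>The fundamental lemma of the calculus of variations\<close>

lemma set_integral_box_eq_0:
  fixes h :: "real ^ 'n::finite \<Rightarrow> real"
  assumes h: "locally_integrable_on U h"
    and zero: "\<And>\<phi>. \<phi> \<in> test_functions U \<Longrightarrow> (LINT x:U|lebesgue. h x * \<phi> x) = 0"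
    and sub: "cbox a b \<subseteq> U"
  shows "(LINT x:box a b|lebesgue. h x) = 0"
proof -
  \<comment> \<open>The closed box is a compact subset of U, so h is integrable on it. There its
    absolute value dominates h times any bump, which prepares dominated convergence of the bumps to
    the indicator of the open box.\<close>
  have int: "integrable lebesgue (\<lambda>x. indicator (cbox a b) x *\<^sub>R h x)"
    using h sub by (auto simp: locally_integrable_on_def set_integrable_def)
  have bump: "box_bump m a b x * indicator (cbox a b) x = box_bump m a b x" for m x
    using box_bump_nonzero_iff[of m a b x] box_subset_cbox[of a b] by (auto simp: indicator_def)
  have "(\<lambda>m. LINT x|lebesgue. box_bump m a b x *\<^sub>R (indicator (cbox a b) x *\<^sub>R h x))
      \<longlonglongrightarrow> (LINT x|lebesgue. indicator (box a b) x *\<^sub>R (indicator (cbox a b) x *\<^sub>R h x))"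
  proof (rule integral_dominated_convergence)
    show "(\<lambda>x. indicat_real (box a b) x *\<^sub>R indicat_real (cbox a b) x *\<^sub>R h x) \<in> borel_measurable lebesgue"
      by (rule borel_measurable_scaleR[OF borel_measurable_indicator borel_measurable_integrable[OF int]]) auto
    have "box_bump m a b \<in> borel_measurable lborel" for m
      using borel_measurable_continuous_onI[OF smooth_on_continuous_on[OF smooth_on_box_bump]] by simp
    then show "(\<lambda>x. box_bump m a b x *\<^sub>R indicat_real (cbox a b) x *\<^sub>R h x) \<in> borel_measurable lebesgue" for m
      by (intro borel_measurable_scaleR[OF measurable_completion borel_measurable_integrable[OF int]])
    show "integrable lebesgue (\<lambda>x. norm (indicator (cbox a b) x *\<^sub>R h x))"
      using int by (rule integrable_norm)
    show "AE x in lebesgue. (\<lambda>m. box_bump m a b x *\<^sub>R indicat_real (cbox a b) x *\<^sub>R h x) \<longlonglongrightarrow>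
        indicat_real (box a b) x *\<^sub>R indicat_real (cbox a b) x *\<^sub>R h x"
      by (intro AE_I2 tendsto_scaleR tendsto_box_bump tendsto_const)
    show "AE x in lebesgue. norm (box_bump m a b x *\<^sub>R indicat_real (cbox a b) x *\<^sub>R h x)
        \<le> norm (indicat_real (cbox a b) x *\<^sub>R h x)" for m
      using box_bump_bounds[of m a b]
      by (intro AE_I2) (simp add: abs_mult mult_left_le_one_le)
  qed
  moreover have "(LINT x|lebesgue. box_bump m a b x *\<^sub>R (indicator (cbox a b) x *\<^sub>R h x)) = 0" for m
  proof -
    have "(LINT x|lebesgue. box_bump m a b x *\<^sub>R (indicator (cbox a b) x *\<^sub>R h x)) =
        (LINT x:U|lebesgue. h x * box_bump m a b x)"
      unfolding set_lebesgue_integral_def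
      using test_functionsD(3)[OF box_bump_test_function[OF sub, of m]] bump[of m]
      by (intro Bochner_Integration.integral_cong)
        (auto simp: indicator_def[of U] mult.assoc[symmetric])
    then show ?thesis
      using zero[OF box_bump_test_function[OF sub]] by simp
  qed
  moreover have "indicat_real (box a b) x * indicat_real (cbox a b) x = indicat_real (box a b) x" for x
    using box_subset_cbox[of a b] by (auto simp: indicator_def)
  ultimately show ?thesis
    by (simp add: LIMSEQ_const_iff set_lebesgue_integral_def mult.assoc[symmetric])
qed

text \<open>Boxes generate the Borel sets and are stable under intersection, so by Dynkin's argument
  the integrals over all Borel sets vanish. The whole space is no box; \<open>total\<close> supplies
  its integral for the complements.\<close>

lemma AE_eq_0_if_box_integrals_0:
  fixes g :: "'a::euclidean_space \<Rightarrow> real"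
  assumes g: "integrable lebesgue g" and zero: "\<And>a b. (LINT x:box a b|lebesgue. g x) = 0"
    and total: "(LINT x|lebesgue. g x) = 0"
  shows "AE x in lebesgue. g x = 0"
proof -
  \<comment> \<open>A Borel representative lets the argument run on \<open>lborel\<close>, whose
    measurable sets the boxes generate.\<close>
  obtain g' where g': "g' \<in> borel_measurable lborel" "AE x in lborel. g x = g' x"
    using completion_ex_borel_measurable_real[OF borel_measurable_integrable[OF g]] by blast
  have ae: "AE x in lebesgue. g x = g' x"
    using g'(2) by (rule AE_completion)
  have meas': "g' \<in> borel_measurable lebesgue"
    using g'(1) by (rule measurable_completion)
  have int_leb: "integrable lebesgue g'"
    using g meas' ae by (subst integrable_cong_AE[symmetric]) auto
  have int': "integrable lborel g'"
    using int_leb g'(1) by (subst (asm) integrable_completion) auto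
  have eq: "(LINT x:A|lborel. g' x) = (LINT x:A|lebesgue. g x)" if A: "A \<in> sets borel" for A
  proof -
    have "(LINT x:A|lborel. g' x) = (LINT x:A|lebesgue. g' x)"
      unfolding set_lebesgue_integral_def using A g'(1)
      by (intro integral_completion[symmetric] borel_measurable_scaleR) auto
    also have "\<dots> = (LINT x:A|lebesgue. g x)"
      unfolding set_lebesgue_integral_def
      using A meas' borel_measurable_integrable[OF g] ae
      by (intro integral_cong_AE borel_measurable_scaleR[OF borel_measurable_indicator]) auto
    finally show ?thesis .
  qed
  have total': "(LINT x|lborel. g' x) = 0"
    using eq[of UNIV] total by (simp add: set_lebesgue_integral_def)
  have set_int: "set_integrable lborel A g'" if "A \<in> sets borel" for A
    unfolding set_integrable_def by (rule integrable_mult_indicator[OF _ int']) (use that in simp)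
  have "AE x in lborel. g' x = 0"
  proof (rule sigma_finite_measure.density_zero[OF lborel.sigma_finite_measure_axioms int'])
    fix A :: "'a set" assume A: "A \<in> sets lborel"
    let ?G = "range (\<lambda>(a, b). box a b :: 'a set)"
    have sets_eq: "sets borel = sigma_sets UNIV ?G"
      unfolding borel_eq_box by (rule sets_measure_of) auto
    have "Int_stable ?G"
    proof (rule Int_stableI)
      fix S T :: "'a set" assume "S \<in> ?G" "T \<in> ?G"
      then obtain a b c d where "S = box a b" "T = box c d" by auto
      then have "S \<inter> T = (\<lambda>(a, b). box a b)
          (\<Sum>i\<in>Basis. max (a \<bullet> i) (c \<bullet> i) *\<^sub>R i, \<Sum>i\<in>Basis. min (b \<bullet> i) (d \<bullet> i) *\<^sub>R i)"
        by (simp add: box_Int_box)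
      then show "S \<inter> T \<in> ?G" by (rule range_eqI)
    qed
    moreover have "?G \<subseteq> Pow UNIV" by simp
    moreover have "A \<in> sigma_sets UNIV ?G" using A sets_eq by simp
    ultimately show "(LINT x:A|lborel. g' x) = 0"
    proof (induction rule: sigma_sets_induct_disjoint)
      case (basic A)
      then show ?case using zero eq by auto
    next
      case (compl A)
      then have A: "A \<in> sets borel" using sets_eq by simp
      then have "set_integrable lborel A g'" "set_integrable lborel (UNIV - A) g'"
        by (auto intro: set_int)
      then have "(LINT x:A \<union> (UNIV - A)|lborel. g' x) = (LINT x:A|lborel. g' x) + (LINT x:UNIV - A|lborel. g' x)"
        by (intro set_integral_Un) auto
      with compl total' show ?case
        by (simp add: set_lebesgue_integral_def)
    next
      case (union A)
      then have A: "A i \<in> sets borel" for i using sets_eq by auto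
      then have "set_integrable lborel (\<Union>i. A i) g'"
        by (auto intro: set_int)
      then have "(LINT x:(\<Union>i. A i)|lborel. g' x) = (\<Sum>i. (LINT x:(A i)|lborel. g' x))"
        using A union.hyps by (intro lebesgue_integral_countable_add) (auto simp: disjoint_family_on_def)
      with union show ?case by simp
    qed (auto simp: set_lebesgue_integral_def)
  qed
  with g'(2) have "AE x in lborel. g x = 0" by eventually_elim simp
  then show ?thesis by (rule AE_completion)
qed

text \<open>U is a countable union of closed boxes, so it suffices to treat one. Its boundary is a
  null set, and h cut off to the open box has vanishing integrals over all boxes.\<close>

lemma AE_eq_0_if_test_function_integrals_0:
  fixes h :: "real ^ 'n::finite \<Rightarrow> real"
  assumes U: "open U" and h: "locally_integrable_on U h"
    and zero: "\<And>\<phi>. \<phi> \<in> test_functions U \<Longrightarrow> (LINT x:U|lebesgue. h x * \<phi> x) = 0"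
  shows "AE x in lebesgue. x \<in> U \<longrightarrow> h x = 0"
proof -
  obtain \<D> where \<D>: "countable \<D>" "\<D> \<subseteq> Pow U" "\<And>X. X \<in> \<D> \<Longrightarrow> \<exists>a b. X = cbox a b" "\<Union>\<D> = U"
    using open_countable_Union_open_cbox[OF U] by metis
  have "AE x in lebesgue. x \<in> X \<longrightarrow> h x = 0" if XD: "X \<in> \<D>" for X
  proof -
    obtain c d where X: "X = cbox c d" using \<D>(3)[OF XD] by blast
    have sub: "cbox c d \<subseteq> U" using \<D>(2) XD X by blast
    define g where "g x = indicator (box c d) x *\<^sub>R h x" for x
    have "set_integrable lebesgue (cbox c d) h"
      using h sub by (auto simp: locally_integrable_on_def)
    then have "set_integrable lebesgue (box c d) h"
      by (rule set_integrable_subset) (auto intro: box_subset_cbox[THEN subsetD])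
    then have int: "integrable lebesgue g"
      by (simp add: g_def[abs_def] set_integrable_def)
    \<comment> \<open>\<open>set_integral_box_eq_0\<close> asks for the closed box inside U; a
      nonempty open box has it as its closure, which stays in \<open>cbox c d\<close>.\<close>
    have box0: "(LINT x:box a b|lebesgue. h x) = 0" if "box a b \<subseteq> box c d" for a b
    proof (cases "box a b = {}")
      case False
      then have "cbox a b = closure (box a b)"
        by (rule closure_box[symmetric])
      also have "\<dots> \<subseteq> cbox c d"
        using that box_subset_cbox[of c d] by (intro closure_minimal closed_cbox) blast
      finally have "cbox a b \<subseteq> cbox c d" .
      with sub show ?thesis
        by (intro set_integral_box_eq_0[OF h zero]) auto
    qed (simp add: set_lebesgue_integral_def)
    have "AE x in lebesgue. g x = 0"
    proof (rule AE_eq_0_if_box_integrals_0[OF int])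
      fix a b
      obtain a' b' where ab: "box a b \<inter> box c d = box a' b'"
        by (simp add: box_Int_box)
      have "(LINT x:box a b|lebesgue. g x) = (LINT x:box a b \<inter> box c d|lebesgue. h x)"
        unfolding set_lebesgue_integral_def g_def
        by (intro Bochner_Integration.integral_cong) (auto simp: indicator_def)
      then show "(LINT x:box a b|lebesgue. g x) = 0"
        using box0[of a' b'] ab by (metis Int_lower2)
    next
      show "(LINT x|lebesgue. g x) = 0"
        using box0[of c d] by (simp add: g_def set_lebesgue_integral_def)
    qed
    moreover have "AE x in lebesgue. x \<notin> cbox c d - box c d"
      using negligible_frontier_interval[of c d] by (intro AE_not_in) (simp add: negligible_iff_null_sets)
    ultimately show ?thesis
      unfolding X by eventually_elim (auto simp: g_def indicator_def split: if_splits)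
  qed
  then have "AE x in lebesgue. \<forall>X\<in>\<D>. x \<in> X \<longrightarrow> h x = 0"
    unfolding AE_ball_countable[OF \<D>(1)] by blast
  then show ?thesis
    by eventually_elim (use \<D>(4) in auto)
qed

text \<open>The weak derivative picked by \<open>SOME\<close> and the classical one have equal
  integrals against every test function, so their difference falls under the fundamental
  lemma.\<close>

lemma weak_deriv_AE_eq:
  fixes f :: "real ^ 'n::finite \<Rightarrow> real"
  assumes U: "open U" and f: "smooth_on UNIV f"
  shows "AE x in lebesgue. x \<in> U \<longrightarrow> weak_deriv U \<alpha> f x = mderiv \<alpha> f x"
proof -
  let ?w = "weak_deriv U \<alpha> f" and ?c = "mderiv \<alpha> f"
  have w: "is_weak_deriv U \<alpha> f ?w"
    unfolding weak_deriv_def using someI_ex[of "is_weak_deriv U \<alpha> f"] is_weak_deriv_mderiv[OF f] by blast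
  have c: "is_weak_deriv U \<alpha> f ?c"
    by (rule is_weak_deriv_mderiv[OF f])
  have li: "locally_integrable_on U ?w" "locally_integrable_on U ?c"
    using w c by (auto simp: is_weak_deriv_def)
  have "AE x in lebesgue. x \<in> U \<longrightarrow> ?w x - ?c x = 0"
  proof (rule AE_eq_0_if_test_function_integrals_0[OF U])
    show "locally_integrable_on U (\<lambda>x. ?w x - ?c x)"
      using li unfolding locally_integrable_on_def by (auto intro!: set_integral_diff(1))
    fix \<phi> assume \<phi>: "\<phi> \<in> test_functions U"
    let ?S = "closure {x. \<phi> x \<noteq> 0}"
    have S: "compact ?S" "?S \<subseteq> U"
      using \<phi> by (auto simp: test_functions_def)
    \<comment> \<open>\<open>u\<close> may fail to be integrable on U; the test function is bounded
      and confines the product to a compact set on which \<open>u\<close> is integrable.\<close>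
    have int: "set_integrable lebesgue U (\<lambda>x. u x * \<phi> x)" if u: "locally_integrable_on U u" for u
    proof -
      have "bounded (\<phi> ` ?S)"
        by (intro compact_imp_bounded compact_continuous_image S
            continuous_on_subset[OF smooth_on_continuous_on[OF test_functionsD(1)[OF \<phi>]]]) auto
      then obtain B where B: "\<And>x. x \<in> ?S \<Longrightarrow> norm (\<phi> x) \<le> B"
        by (auto simp: bounded_iff)
      have uS: "integrable lebesgue (\<lambda>x. indicator ?S x *\<^sub>R u x)"
        using u S by (auto simp: locally_integrable_on_def set_integrable_def)
      have "\<phi> \<in> borel_measurable lborel"
        using borel_measurable_continuous_onI[OF smooth_on_continuous_on[OF test_functionsD(1)[OF \<phi>]]]
        by simp
      then have "(\<lambda>x. (indicator ?S x *\<^sub>R u x) * \<phi> x) \<in> borel_measurable lebesgue"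
        by (rule borel_measurable_times[OF borel_measurable_integrable[OF uS] measurable_completion])
      then have "integrable lebesgue (\<lambda>x. (indicator ?S x *\<^sub>R u x) * \<phi> x)"
        using B
        by (intro Bochner_Integration.integrable_bound[OF integrable_mult_right[OF integrable_norm[OF uS], of B]] AE_I2)
          (auto simp: indicator_def abs_mult mult.commute[of "\<bar>u _\<bar>"] intro!: mult_right_mono
            intro: order_trans[OF _ abs_ge_self])
      moreover have "(\<lambda>x. (indicator ?S x *\<^sub>R u x) * \<phi> x) = (\<lambda>x. indicator U x *\<^sub>R (u x * \<phi> x))"
        using closure_subset[of "{x. \<phi> x \<noteq> 0}"] S(2) by (auto simp: indicator_def fun_eq_iff)
      ultimately show ?thesis by (simp add: set_integrable_def)
    qed
    have "(- 1) ^ sum \<alpha> UNIV * (LINT x:U|lebesgue. ?w x * \<phi> x) =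
        (- 1) ^ sum \<alpha> UNIV * (LINT x:U|lebesgue. ?c x * \<phi> x)"
      using w c \<phi> by (simp add: is_weak_deriv_def)
    then have "(LINT x:U|lebesgue. ?w x * \<phi> x) = (LINT x:U|lebesgue. ?c x * \<phi> x)"
      by simp
    then show "(LINT x:U|lebesgue. (?w x - ?c x) * \<phi> x) = 0"
      using set_integral_diff(2)[OF int[OF li(1)] int[OF li(2)]] by (simp add: left_diff_distrib)
  qed
  then show ?thesis by eventually_elim simp
qed

section \<open>Sobolev seminorms of smooth functions\<close>

lemma AE_lebesgue_on_open_iff:
  assumes "open U"
  shows "(AE x in lebesgue_on U. P x) \<longleftrightarrow> (AE x in lebesgue. x \<in> U \<longrightarrow> P x)"
  using assms by (intro AE_restrict_space_iff) auto

lemma borel_measurable_lebesgue_on_continuous: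
  fixes g :: "'a::euclidean_space \<Rightarrow> real"
  assumes "continuous_on UNIV g"
  shows "g \<in> borel_measurable (lebesgue_on U)"
proof -
  have "g \<in> borel_measurable lborel"
    using borel_measurable_continuous_onI[OF assms] by simp
  then show ?thesis
    by (intro measurable_restrict_space1 measurable_completion)
qed

text \<open>Lebesgue measure is complete, so equality almost everywhere with the continuous
  \<open>mderiv \<alpha> f\<close> is enough.\<close>

lemma borel_measurable_weak_deriv:
  assumes U: "open U" and f: "smooth_on UNIV f"
  shows "weak_deriv U \<alpha> f \<in> borel_measurable (lebesgue_on U)"
proof (rule borel_measurable_if_D)
  have U': "U \<in> sets lebesgue" using U by auto
  have "(\<lambda>x. if x \<in> U then mderiv \<alpha> f x else 0) \<in> borel_measurable lebesgue"
    by (intro borel_measurable_if_I[OF _ U'] borel_measurable_lebesgue_on_continuous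
        smooth_on_continuous_on smooth_on_mderiv f)
  moreover have "AE x in lebesgue. (if x \<in> U then mderiv \<alpha> f x else 0)
      = (if x \<in> U then weak_deriv U \<alpha> f x else 0)"
    using weak_deriv_AE_eq[OF U f, of \<alpha>] by eventually_elim auto
  ultimately show "(\<lambda>x. if x \<in> U then weak_deriv U \<alpha> f x else 0) \<in> borel_measurable lebesgue"
    by (rule borel_measurable_AE)
qed

lemma Lp_norm_AE_cong:
  assumes f: "f \<in> borel_measurable (lebesgue_on U)" and g: "g \<in> borel_measurable (lebesgue_on U)"
    and eq: "AE x in lebesgue_on U. f x = g x"
  shows "Lp_norm s U f = Lp_norm s U g"
proof -
  have "esssup (lebesgue_on U) (\<lambda>x. ennreal \<bar>f x\<bar>) = esssup (lebesgue_on U) (\<lambda>x. ennreal \<bar>g x\<bar>)"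
    using f g eq by (intro esssup_AE_cong) (auto elim: eventually_mono)
  moreover have "(\<integral>\<^sup>+ x. ennreal (\<bar>f x\<bar> powr enn2real s) \<partial>lebesgue_on U) =
      (\<integral>\<^sup>+ x. ennreal (\<bar>g x\<bar> powr enn2real s) \<partial>lebesgue_on U)"
    using eq by (intro nn_integral_cong_AE) (auto elim: eventually_mono)
  ultimately show ?thesis using f g by (simp add: Lp_norm_def)
qed

lemma Lp_norm_weak_deriv:
  assumes U: "open U" and f: "smooth_on UNIV f"
  shows "Lp_norm s U (weak_deriv U \<alpha> f) = Lp_norm s U (mderiv \<alpha> f)"
proof (rule Lp_norm_AE_cong[OF borel_measurable_weak_deriv[OF U f]])
  show "mderiv \<alpha> f \<in> borel_measurable (lebesgue_on U)"
    by (intro borel_measurable_lebesgue_on_continuous smooth_on_continuous_on smooth_on_mderiv f)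
  show "AE x in lebesgue_on U. weak_deriv U \<alpha> f x = mderiv \<alpha> f x"
    using weak_deriv_AE_eq[OF U f] by (simp add: AE_lebesgue_on_open_iff[OF U])
qed

text \<open>An essential bound holds almost everywhere on U. The set where |g| <= c is closed, and a
  closed set that contains almost all of an open set contains all of it.\<close>

lemma Lp_norm_infinity_le_iff:
  fixes g :: "'a::euclidean_space \<Rightarrow> real"
  assumes U: "open U" and g: "continuous_on UNIV g" and c: "c \<ge> 0"
  shows "Lp_norm \<infinity> U g \<le> ennreal c \<longleftrightarrow> (\<forall>x\<in>U. \<bar>g x\<bar> \<le> c)"
proof -
  have meas: "g \<in> borel_measurable (lebesgue_on U)"
    by (rule borel_measurable_lebesgue_on_continuous[OF g])
  then have eq: "Lp_norm \<infinity> U g = esssup (lebesgue_on U) (\<lambda>x. ennreal \<bar>g x\<bar>)"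
    by (simp add: Lp_norm_def)
  have meas': "(\<lambda>x. ennreal \<bar>g x\<bar>) \<in> borel_measurable (lebesgue_on U)"
    using meas by measurable
  show ?thesis
  proof
    assume le: "Lp_norm \<infinity> U g \<le> ennreal c"
    have "AE x in lebesgue_on U. ennreal \<bar>g x\<bar> \<le> esssup (lebesgue_on U) (\<lambda>x. ennreal \<bar>g x\<bar>)"
      by (rule esssup_AE)
    then have "AE x in lebesgue_on U. \<bar>g x\<bar> \<le> c"
    proof eventually_elim
      case (elim x)
      also note le[unfolded eq]
      finally show ?case using c by (simp add: ennreal_le_iff)
    qed
    then have ae: "AE x in lebesgue. x \<in> U \<longrightarrow> x \<in> {x. \<bar>g x\<bar> \<le> c}"
      by (simp add: AE_lebesgue_on_open_iff[OF U])
    have "closed {x. \<bar>g x\<bar> \<le> c}"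
      using g by (intro closed_Collect_le continuous_on_rabs continuous_on_const)
    from mem_closed_if_AE_lebesgue_open[OF U this ae]
    show "\<forall>x\<in>U. \<bar>g x\<bar> \<le> c" by blast
  next
    assume "\<forall>x\<in>U. \<bar>g x\<bar> \<le> c"
    then show "Lp_norm \<infinity> U g \<le> ennreal c"
      unfolding eq using meas' by (intro esssup_I AE_I2) (auto intro: ennreal_leI)
  qed
qed

text \<open>Here U may be unbounded, because the derivative bounds for \<omega> are given on the
  whole space. A finite bound excludes the default value \<infinity>, so f lies in the Sobolev
  space.\<close>

lemma sobolev_seminorm_infinity_bound:
  assumes U: "open U" and f: "smooth_on UNIV f" and c: "c \<ge> 0"
    and le: "sobolev_seminorm (length xs) \<infinity> U f \<le> ennreal c" and x: "x \<in> U"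
  shows "\<bar>pderivs xs f x\<bar> \<le> c"
proof -
  have "sobolev_seminorm (length xs) \<infinity> U f \<noteq> \<infinity>"
    using le by (auto simp: top_unique)
  then have eq: "sobolev_seminorm (length xs) \<infinity> U f =
      (SUP \<alpha>\<in>{\<alpha>. sum \<alpha> UNIV = length xs}. Lp_norm \<infinity> U (mderiv \<alpha> f))"
    by (auto simp: sobolev_seminorm_def Lp_norm_weak_deriv[OF U f] split: if_splits)
  have "Lp_norm \<infinity> U (mderiv (count_list xs) f) \<le> ennreal c"
    by (rule order_trans[OF SUP_upper le[unfolded eq]]) (simp add: length_eq_sum_count_list)
  then show ?thesis
    using Lp_norm_infinity_le_iff[OF U smooth_on_continuous_on[OF smooth_on_mderiv[OF f]] c] x
    by (simp add: pderivs_eq_mderiv[OF f])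
qed

section \<open>Seminorms of smooth functions on a bounded open set, as real numbers\<close>

locale bounded_open_set =
  fixes U :: "(real ^ 'n::finite) set"
  assumes U_open: "open U" and U_bounded: "bounded U"
begin

lemma U_lmeasurable: "U \<in> lmeasurable"
  by (rule lmeasurable_open[OF U_bounded U_open])

lemma continuous_bounded_on_U:
  fixes g :: "real ^ 'n \<Rightarrow> real"
  assumes "continuous_on UNIV g"
  obtains B where "B \<ge> 0" "\<And>x. x \<in> U \<Longrightarrow> \<bar>g x\<bar> \<le> B"
proof -
  have "bounded (g ` closure U)"
    using U_bounded assms
    by (intro compact_imp_bounded compact_continuous_image) (auto intro: continuous_on_subset)
  then obtain B where "B > 0" "\<And>x. x \<in> closure U \<Longrightarrow> norm (g x) \<le> B"
    by (auto simp: bounded_pos)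
  then show ?thesis
    using that[of B] closure_subset[of U] by auto
qed

lemma integrable_lebesgue_on_U:
  fixes g :: "real ^ 'n \<Rightarrow> real"
  assumes g: "continuous_on UNIV g"
  shows "integrable (lebesgue_on U) g"
proof -
  obtain B where B: "B \<ge> 0" "\<And>x. x \<in> U \<Longrightarrow> \<bar>g x\<bar> \<le> B"
    using continuous_bounded_on_U[OF g] by blast
  interpret finite_measure "lebesgue_on U"
    by (rule finite_measure_lebesgue_on[OF U_lmeasurable])
  show ?thesis
    by (rule integrable_const_bound[of _ B])
      (use B in \<open>auto intro!: AE_I2 borel_measurable_lebesgue_on_continuous[OF g]\<close>)
qed

lemma Lp_norm_2:
  assumes g: "continuous_on UNIV g"
  shows "Lp_norm 2 U g = ennreal (sqrt (LINT x|lebesgue_on U. (g x)\<^sup>2))"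
proof -
  have int: "integrable (lebesgue_on U) (\<lambda>x. (g x)\<^sup>2)"
    by (intro integrable_lebesgue_on_U continuous_on_power g)
  have "(\<integral>\<^sup>+ x. ennreal (\<bar>g x\<bar> powr enn2real 2) \<partial>lebesgue_on U) =
      (\<integral>\<^sup>+ x. ennreal ((g x)\<^sup>2) \<partial>lebesgue_on U)"
    by (intro nn_integral_cong) (simp add: powr_numeral)
  also have "\<dots> = ennreal (LINT x|lebesgue_on U. (g x)\<^sup>2)"
    by (intro nn_integral_eq_integral int) auto
  finally show ?thesis
    using borel_measurable_lebesgue_on_continuous[OF g, of U]
    by (simp add: Lp_norm_def ennreal_powr_def powr_half_sqrt)
qed

lemma Lp_norm_finite:
  assumes g: "continuous_on UNIV g" and s: "s \<in> {2, \<infinity>}"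
  shows "Lp_norm s U g < \<infinity>"
proof -
  obtain B where "B \<ge> 0" "\<And>x. x \<in> U \<Longrightarrow> \<bar>g x\<bar> \<le> B"
    using continuous_bounded_on_U[OF g] by blast
  then have "Lp_norm \<infinity> U g \<le> ennreal B"
    using Lp_norm_infinity_le_iff[OF U_open g] by blast
  then have "Lp_norm \<infinity> U g < \<infinity>"
    by (rule order_le_less_trans) simp
  with s show ?thesis by (auto simp: Lp_norm_2[OF g])
qed

lemma smooth_in_sobolev_space:
  assumes f: "smooth_on UNIV f" and s: "s \<in> {2, \<infinity>}"
  shows "f \<in> sobolev_space j s U"
  unfolding sobolev_space_def
  using is_weak_deriv_mderiv[OF f] Lp_norm_finite[OF smooth_on_continuous_on[OF smooth_on_mderiv[OF f]] s]
  by blast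

text \<open>Real values make ordinary arithmetic available;
  \<open>sobolev_seminorm_infinity_eq\<close> and \<open>sobolev_seminorm_2_eq\<close> translate
  back for smooth functions, whose extended seminorms are finite.\<close>

definition sup_seminorm :: "nat \<Rightarrow> (real ^ 'n \<Rightarrow> real) \<Rightarrow> real" where
  "sup_seminorm j f = enn2real (sobolev_seminorm j \<infinity> U f)"

definition L2_seminorm :: "nat \<Rightarrow> (real ^ 'n \<Rightarrow> real) \<Rightarrow> real" where
  "L2_seminorm j f = sqrt (\<Sum>\<alpha> | sum \<alpha> UNIV = j. LINT x|lebesgue_on U. (mderiv \<alpha> f x)\<^sup>2)"

lemma sobolev_seminorm_infinity_le:
  assumes f: "smooth_on UNIV f" and c: "c \<ge> 0"
    and le: "\<And>xs x. length xs = j \<Longrightarrow> x \<in> U \<Longrightarrow> \<bar>pderivs xs f x\<bar> \<le> c"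
  shows "sobolev_seminorm j \<infinity> U f \<le> ennreal c"
proof -
  have "sobolev_seminorm j \<infinity> U f = (SUP \<alpha>\<in>{\<alpha>. sum \<alpha> UNIV = j}. Lp_norm \<infinity> U (mderiv \<alpha> f))"
    using smooth_in_sobolev_space[OF f]
    by (simp add: sobolev_seminorm_def Lp_norm_weak_deriv[OF U_open f])
  also have "\<dots> \<le> ennreal c"
  proof (rule SUP_least)
    fix \<alpha> :: "'n \<Rightarrow> nat" assume \<alpha>: "\<alpha> \<in> {\<alpha>. sum \<alpha> UNIV = j}"
    obtain xs where "length xs = sum \<alpha> UNIV" "\<And>f. mderiv \<alpha> f = pderivs xs f"
      using mderiv_eq_pderivs by blast
    with \<alpha> le have "\<forall>x\<in>U. \<bar>mderiv \<alpha> f x\<bar> \<le> c"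
      by simp
    then show "Lp_norm \<infinity> U (mderiv \<alpha> f) \<le> ennreal c"
      using Lp_norm_infinity_le_iff[OF U_open smooth_on_continuous_on[OF smooth_on_mderiv[OF f]] c] by blast
  qed
  finally show ?thesis .
qed

text \<open>Only finiteness is at stake: there are finitely many lists of length j, each derivative
  is bounded on U, and the sum of these bounds is a crude common one.\<close>

lemma sobolev_seminorm_infinity_eq:
  assumes f: "smooth_on UNIV f"
  shows "sobolev_seminorm j \<infinity> U f = ennreal (sup_seminorm j f)"
proof -
  have "\<exists>B\<ge>0. \<forall>x\<in>U. \<bar>pderivs xs f x\<bar> \<le> B" for xs
    using continuous_bounded_on_U[OF smooth_on_continuous_on[OF smooth_on_pderivs[OF f]]] by metis
  then obtain B where B: "\<And>xs. B xs \<ge> 0" "\<And>xs x. x \<in> U \<Longrightarrow> \<bar>pderivs xs f x\<bar> \<le> B xs"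
    by metis
  let ?L = "{xs::'n list. set xs \<subseteq> UNIV \<and> length xs = j}"
  have fin: "finite ?L" by (rule finite_lists_length_eq) simp
  have "sobolev_seminorm j \<infinity> U f \<le> ennreal (\<Sum>xs\<in>?L. B xs)"
  proof (rule sobolev_seminorm_infinity_le[OF f])
    show "(\<Sum>xs\<in>?L. B xs) \<ge> 0" by (intro sum_nonneg B)
    fix xs :: "'n list" and x assume "length xs = j" "x \<in> U"
    then show "\<bar>pderivs xs f x\<bar> \<le> (\<Sum>xs\<in>?L. B xs)"
      using member_le_sum[of xs ?L B] fin B by (auto intro: order_trans)
  qed
  then have "sobolev_seminorm j \<infinity> U f < \<infinity>"
    by (rule order_le_less_trans) simp
  then show ?thesis
    unfolding sup_seminorm_def by simp
qed

lemma sup_seminorm_nonneg: "sup_seminorm j f \<ge> 0"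
  by (simp add: sup_seminorm_def)

lemma pderivs_le_sup_seminorm:
  assumes "smooth_on UNIV f" "x \<in> U" "length xs = j"
  shows "\<bar>pderivs xs f x\<bar> \<le> sup_seminorm j f"
  by (rule sobolev_seminorm_infinity_bound[OF U_open assms(1) sup_seminorm_nonneg _ assms(2)])
    (simp only: sobolev_seminorm_infinity_eq[OF assms(1)] assms(3) order_refl)

lemma sup_seminorm_le:
  assumes "smooth_on UNIV f" "c \<ge> 0"
    and "\<And>xs x. length xs = j \<Longrightarrow> x \<in> U \<Longrightarrow> \<bar>pderivs xs f x\<bar> \<le> c"
  shows "sup_seminorm j f \<le> c"
proof -
  have "sobolev_seminorm j \<infinity> U f \<le> ennreal c"
    by (rule sobolev_seminorm_infinity_le) (use assms in auto)
  then show ?thesis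
    using assms(2) unfolding sobolev_seminorm_infinity_eq[OF assms(1)] by simp
qed

lemma sobolev_seminorm_2_eq:
  assumes f: "smooth_on UNIV f"
  shows "sobolev_seminorm j 2 U f = ennreal (L2_seminorm j f)"
proof -
  let ?I = "\<lambda>\<alpha>. LINT x|lebesgue_on U. (mderiv \<alpha> f x)\<^sup>2"
  have nn: "?I \<alpha> \<ge> 0" for \<alpha> by (intro integral_nonneg_AE AE_I2) auto
  have "ennreal_powr (Lp_norm 2 U (mderiv \<alpha> f)) (enn2real 2) = ennreal (?I \<alpha>)" for \<alpha>
    using nn[of \<alpha>]
    by (simp add: Lp_norm_2[OF smooth_on_continuous_on[OF smooth_on_mderiv[OF f]]] ennreal_powr_def
        powr_numeral)
  moreover have "(\<Sum>\<alpha> | sum \<alpha> UNIV = j. ennreal (?I \<alpha>)) = ennreal (\<Sum>\<alpha> | sum \<alpha> UNIV = j. ?I \<alpha>)"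
    by (intro sum_ennreal nn)
  ultimately show ?thesis
    using smooth_in_sobolev_space[OF f]
    by (simp add: sobolev_seminorm_def Lp_norm_weak_deriv[OF U_open f] L2_seminorm_def
        ennreal_powr_def powr_half_sqrt sum_nonneg nn)
qed

lemma L2_seminorm_nonneg: "L2_seminorm j f \<ge> 0"
  unfolding L2_seminorm_def by (intro real_sqrt_ge_zero sum_nonneg integral_nonneg_AE AE_I2) auto

lemma mderiv_diff:
  assumes "smooth_on UNIV f" "smooth_on UNIV g"
  shows "mderiv \<alpha> (\<lambda>x. f x - g x) x = mderiv \<alpha> f x - mderiv \<alpha> g x"
proof -
  have "mderiv \<alpha> (\<lambda>x. f x + (- 1) * g x) x = mderiv \<alpha> f x + (- 1) * mderiv \<alpha> g x"
    unfolding mderiv_def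
    by (simp only: pderivs_add[OF assms(1) smooth_on_cmult[OF assms(2)]] pderivs_cmult[OF assms(2)])
  then show ?thesis by simp
qed

text \<open>The factor 2 spares Minkowski's inequality: \<open>(a - b)\<^sup>2 \<le> 2 a\<^sup>2 + 2 b\<^sup>2\<close> suffices.\<close>

lemma L2_seminorm_diff_le:
  assumes f: "smooth_on UNIV f" and g: "smooth_on UNIV g"
  shows "L2_seminorm j (\<lambda>x. f x - g x) \<le> 2 * (L2_seminorm j f + L2_seminorm j g)"
proof -
  let ?I = "\<lambda>f \<alpha>. LINT x|lebesgue_on U. (mderiv \<alpha> f x)\<^sup>2"
  let ?S = "\<lambda>f. \<Sum>\<alpha> | sum \<alpha> UNIV = j. ?I f \<alpha>"
  have int: "integrable (lebesgue_on U) (\<lambda>x. (mderiv \<alpha> f x)\<^sup>2)" if "smooth_on UNIV f" for f \<alpha>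
    by (intro integrable_lebesgue_on_U continuous_on_power smooth_on_continuous_on smooth_on_mderiv that)
  have "?I (\<lambda>x. f x - g x) \<alpha> \<le> 2 * ?I f \<alpha> + 2 * ?I g \<alpha>" for \<alpha>
  proof -
    have "?I (\<lambda>x. f x - g x) \<alpha> \<le> (LINT x|lebesgue_on U. 2 * (mderiv \<alpha> f x)\<^sup>2 + 2 * (mderiv \<alpha> g x)\<^sup>2)"
    proof (rule integral_mono)
      fix x
      have "0 \<le> (mderiv \<alpha> f x + mderiv \<alpha> g x)\<^sup>2" by simp
      then show "(mderiv \<alpha> (\<lambda>x. f x - g x) x)\<^sup>2 \<le> 2 * (mderiv \<alpha> f x)\<^sup>2 + 2 * (mderiv \<alpha> g x)\<^sup>2"
        by (simp add: mderiv_diff[OF f g] power2_eq_square algebra_simps)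
    qed (intro int smooth_on_diff f g Bochner_Integration.integrable_add integrable_mult_right)+
    also have "\<dots> = 2 * ?I f \<alpha> + 2 * ?I g \<alpha>"
      using int[OF f, of \<alpha>] int[OF g, of \<alpha>] by simp
    finally show ?thesis .
  qed
  then have "?S (\<lambda>x. f x - g x) \<le> (\<Sum>\<alpha> | sum \<alpha> UNIV = j. 2 * ?I f \<alpha> + 2 * ?I g \<alpha>)"
    by (intro sum_mono)
  also have "\<dots> = 2 * ?S f + 2 * ?S g"
    by (simp add: sum.distrib sum_distrib_left)
  also have "\<dots> = 2 * (L2_seminorm j f)\<^sup>2 + 2 * (L2_seminorm j g)\<^sup>2"
    by (simp add: L2_seminorm_def sum_nonneg integral_nonneg_AE)
  also have "\<dots> \<le> (2 * (L2_seminorm j f + L2_seminorm j g))\<^sup>2"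
    using L2_seminorm_nonneg[of j f] L2_seminorm_nonneg[of j g]
    by (simp add: power2_eq_square algebra_simps)
  finally show ?thesis
    unfolding L2_seminorm_def[of j "\<lambda>x. f x - g x"]
    using L2_seminorm_nonneg[of j f] L2_seminorm_nonneg[of j g]
    by (intro real_le_lsqrt) auto
qed

lemma L2_seminorm_le_sup_seminorm:
  assumes f: "smooth_on UNIV f"
  shows "L2_seminorm j f \<le>
    sqrt (real (card {\<alpha>::'n \<Rightarrow> nat. sum \<alpha> UNIV = j}) * measure lebesgue U) * sup_seminorm j f"
proof -
  let ?I = "\<lambda>\<alpha>. LINT x|lebesgue_on U. (mderiv \<alpha> f x)\<^sup>2"
  interpret finite_measure "lebesgue_on U"
    by (rule finite_measure_lebesgue_on[OF U_lmeasurable])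
  have "?I \<alpha> \<le> measure lebesgue U * (sup_seminorm j f)\<^sup>2" if \<alpha>: "sum \<alpha> UNIV = j" for \<alpha>
  proof -
    obtain xs where xs: "length xs = sum \<alpha> UNIV" "\<And>f. mderiv \<alpha> f = pderivs xs f"
      using mderiv_eq_pderivs by blast
    have "?I \<alpha> \<le> (LINT x|lebesgue_on U. (sup_seminorm j f)\<^sup>2)"
    proof (rule integral_mono)
      show "integrable (lebesgue_on U) (\<lambda>x. (mderiv \<alpha> f x)\<^sup>2)"
        by (intro integrable_lebesgue_on_U continuous_on_power smooth_on_continuous_on smooth_on_mderiv f)
      fix x assume "x \<in> space (lebesgue_on U)"
      then have "\<bar>mderiv \<alpha> f x\<bar> \<le> sup_seminorm j f"
        using pderivs_le_sup_seminorm[OF f, of x xs j] xs \<alpha> by simp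
      then show "(mderiv \<alpha> f x)\<^sup>2 \<le> (sup_seminorm j f)\<^sup>2"
        using sup_seminorm_nonneg[of j f] by (simp add: abs_le_square_iff[symmetric])
    qed simp
    also have "\<dots> = measure lebesgue U * (sup_seminorm j f)\<^sup>2"
      using U_open by (simp add: measure_restrict_space)
    finally show ?thesis .
  qed
  then have "(\<Sum>\<alpha> | sum \<alpha> UNIV = j. ?I \<alpha>) \<le>
      (\<Sum>\<alpha> | sum (\<alpha>::'n \<Rightarrow> nat) UNIV = j. measure lebesgue U * (sup_seminorm j f)\<^sup>2)"
    by (intro sum_mono) auto
  then have "L2_seminorm j f \<le> sqrt (real (card {\<alpha>::'n \<Rightarrow> nat. sum \<alpha> UNIV = j}) *
      measure lebesgue U * (sup_seminorm j f)\<^sup>2)"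
    unfolding L2_seminorm_def by (intro real_sqrt_le_mono) (simp add: mult.assoc)
  also have "\<dots> = sqrt (real (card {\<alpha>::'n \<Rightarrow> nat. sum \<alpha> UNIV = j}) * measure lebesgue U) * sup_seminorm j f"
    using sup_seminorm_nonneg[of j f] by (simp add: real_sqrt_mult)
  finally show ?thesis .
qed

end

section \<open>Leibniz estimates and superapproximation\<close>

text \<open>The Leibniz formula without binomial coefficients: every differentiation turns a product
  into two, so l derivatives give 2^l products, each at most M. In the induction the differentiated
  factor has its bound sequence shifted by one.\<close>

lemma pderivs_mult_bound:
  assumes "smooth_on UNIV f" "smooth_on UNIV g"
    and "\<And>ys. length ys \<le> length xs \<Longrightarrow> \<bar>pderivs ys f x\<bar> \<le> a (length ys)"
    and "\<And>ys. length ys \<le> length xs \<Longrightarrow> \<bar>pderivs ys g x\<bar> \<le> b (length ys)"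
    and "\<And>i. i \<le> length xs \<Longrightarrow> a (length xs - i) * b i \<le> M"
  shows "\<bar>pderivs xs (\<lambda>x. f x * g x) x\<bar> \<le> 2 ^ length xs * M"
  using assms
proof (induction xs arbitrary: f g a b)
  case Nil
  have "\<bar>f x\<bar> * \<bar>g x\<bar> \<le> a 0 * b 0"
    using Nil.prems(3)[of "[]"] Nil.prems(4)[of "[]"] by (intro mult_mono) auto
  with Nil.prems(5)[of 0] show ?case by (simp add: abs_mult)
next
  case (Cons y ys)
  have "\<bar>pderivs ys (\<lambda>x. f x * pd y g x) x\<bar> \<le> 2 ^ length ys * M"
  proof (rule Cons.IH[of _ _ a "\<lambda>i. b (Suc i)"])
    show "\<bar>pderivs zs (pd y g) x\<bar> \<le> b (Suc (length zs))" if "length zs \<le> length ys" for zs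
      using Cons.prems(4)[of "y # zs"] that by (simp add: pderivs_Cons del: pderivs.simps(2))
    show "a (length ys - i) * b (Suc i) \<le> M" if "i \<le> length ys" for i
      using Cons.prems(5)[of "Suc i"] that by simp
  qed (use Cons.prems in \<open>auto intro: smooth_on_pd\<close>)
  moreover have "\<bar>pderivs ys (\<lambda>x. pd y f x * g x) x\<bar> \<le> 2 ^ length ys * M"
  proof (rule Cons.IH[of _ _ "\<lambda>i. a (Suc i)" b])
    show "\<bar>pderivs zs (pd y f) x\<bar> \<le> a (Suc (length zs))" if "length zs \<le> length ys" for zs
      using Cons.prems(3)[of "y # zs"] that by (simp add: pderivs_Cons del: pderivs.simps(2))
    show "a (Suc (length ys - i)) * b i \<le> M" if "i \<le> length ys" for i
      using Cons.prems(5)[of i] that by (simp add: Suc_diff_le)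
  qed (use Cons.prems in \<open>auto intro: smooth_on_pd\<close>)
  moreover have "pderivs (y # ys) (\<lambda>x. f x * g x) x =
      pderivs ys (\<lambda>x. f x * pd y g x) x + pderivs ys (\<lambda>x. pd y f x * g x) x"
    unfolding pderivs_Cons pd_mult[OF Cons.prems(1,2)]
    by (subst pderivs_add) (auto intro: smooth_on_mult smooth_on_pd Cons.prems(1,2))
  ultimately show ?case by simp
qed

text \<open>The separate term \<open>\<gamma> 0\<close> fits the recursion for the weighted
  seminorms of \<open>chi\<close>, where the order 0 enters at every step.\<close>

lemma discrete_gronwall:
  fixes X \<gamma> :: "nat \<Rightarrow> real"
  assumes E: "E \<ge> 0" and \<gamma>: "\<And>i. i \<le> m \<Longrightarrow> \<gamma> i \<ge> 0"
    and X: "\<And>j. j \<le> m \<Longrightarrow> X j \<le> E * (\<gamma> j + \<gamma> 0 + (\<Sum>i<j. X i))"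
    and "j \<le> m"
  shows "X j \<le> 2 * E * (1 + E) ^ j * (\<Sum>i\<le>j. \<gamma> i)"
  using \<open>j \<le> m\<close>
proof (induction j rule: less_induct)
  case (less j)
  let ?G = "\<lambda>j. \<Sum>i\<le>j. \<gamma> i"
  have G: "\<gamma> i \<le> ?G j" if "i \<le> j" for i
    using that \<gamma> less.prems by (intro member_le_sum) auto
  have "X i \<le> 2 * E * (1 + E) ^ i * ?G j" if "i < j" for i
  proof -
    have "?G i \<le> ?G j" using that \<gamma> less.prems by (intro sum_mono2) auto
    then have "2 * E * (1 + E) ^ i * ?G i \<le> 2 * E * (1 + E) ^ i * ?G j"
      using E by (intro mult_left_mono) auto
    with less.IH[of i] that less.prems show ?thesis by simp
  qed
  then have "(\<Sum>i<j. X i) \<le> (\<Sum>i<j. 2 * E * (1 + E) ^ i * ?G j)"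
    by (intro sum_mono) auto
  also have "\<dots> = 2 * (E * (\<Sum>i<j. (1 + E) ^ i)) * ?G j"
    by (simp add: sum_distrib_left sum_distrib_right mult_ac)
  \<comment> \<open>With this geometric sum, the sum of the X i is at most 2 ((1 + E)^j - 1) G; the
    missing 2 G makes room for \<gamma> j + \<gamma> 0.\<close>
  also have "E * (\<Sum>i<j. (1 + E) ^ i) = (1 + E) ^ j - 1"
    by (induction j) (auto simp: algebra_simps)
  finally have "\<gamma> j + \<gamma> 0 + (\<Sum>i<j. X i) \<le> 2 * (1 + E) ^ j * ?G j"
    using G[of j] G[of 0] by (simp add: algebra_simps)
  then have "E * (\<gamma> j + \<gamma> 0 + (\<Sum>i<j. X i)) \<le> E * (2 * (1 + E) ^ j * ?G j)"
    using E by (rule mult_left_mono)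
  with X[OF less.prems] show ?case by (simp add: mult_ac)
qed

text \<open>In the application t is h/d and \<alpha> i is d^i times the sup seminorm of
  \<open>chi\<close> of order i. For i > m the part t^(i - m) lowers order i to order m; all other
  factors t turn into powers of \<rho>. The exponents \<open>e\<close> are 0 for the first
  inequality and the identity for the second.\<close>

lemma absorb_high_orders:
  fixes \<alpha> :: "nat \<Rightarrow> real"
  assumes \<alpha>: "\<And>i. \<alpha> i \<ge> 0" and t: "0 \<le> t" "t \<le> A * \<rho>" and \<rho>: "0 < \<rho>" "\<rho> \<le> 1"
    and A: "A \<ge> 1" and S: "S \<ge> 0" and m: "m \<le> k"
    and inv: "\<And>i. m < i \<Longrightarrow> i \<le> k \<Longrightarrow> t ^ (i - m) * \<alpha> i \<le> S * \<alpha> m"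
    and e: "\<And>i. e i \<le> i" "\<And>i. e i + (m + 1) \<le> n + i \<or> e i = 0"
  shows "t ^ (k - m) * (\<Sum>i<k + 1. \<rho> ^ (n - (k + 1 - i)) * \<alpha> i)
           \<le> (real k + 1) * A ^ k * (1 + S) * (\<Sum>i\<le>m. \<rho> ^ e i * \<alpha> i)"
proof -
  let ?R = "\<Sum>i\<le>m. \<rho> ^ e i * \<alpha> i"
  have tpow: "t ^ r * \<rho> ^ q \<le> A ^ k * \<rho> ^ p" if "r \<le> k" "p \<le> r + q" for r p q
  proof -
    have "t ^ r \<le> (A * \<rho>) ^ r" using t by (intro power_mono) auto
    then have "t ^ r * \<rho> ^ q \<le> (A * \<rho>) ^ r * \<rho> ^ q" using \<rho> by (intro mult_right_mono) auto
    also have "\<dots> = A ^ r * \<rho> ^ (r + q)" by (simp add: power_mult_distrib power_add mult_ac)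
    also have "\<dots> \<le> A ^ k * \<rho> ^ p"
      using A \<rho> that by (intro mult_mono power_increasing power_decreasing) auto
    finally show ?thesis .
  qed
  have R: "\<rho> ^ e i * \<alpha> i \<le> ?R" if "i \<le> m" for i
    using that \<rho> \<alpha> by (intro member_le_sum) auto
  have R0: "?R \<ge> 0" using \<rho> \<alpha> by (intro sum_nonneg) auto
  have "t ^ (k - m) * (\<rho> ^ (n - (k + 1 - i)) * \<alpha> i) \<le> A ^ k * (1 + S) * ?R" if i: "i < k + 1" for i
  proof (cases "i \<le> m")
    case True
    \<comment> \<open>The subtraction \<open>n - (k + 1 - i)\<close> is truncated. If n + i <= k it
      gives 0, and \<open>e i <= k - m\<close> follows from the condition on \<open>e\<close>;
      otherwise the exponents add up to n + i - m - 1.\<close>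
    have "t ^ (k - m) * \<rho> ^ (n - (k + 1 - i)) \<le> A ^ k * \<rho> ^ e i"
      using e(2)[of i] e(1)[of i] True m by (intro tpow) linarith+
    then have "t ^ (k - m) * \<rho> ^ (n - (k + 1 - i)) * \<alpha> i \<le> A ^ k * \<rho> ^ e i * \<alpha> i"
      using \<alpha> by (intro mult_right_mono) auto
    also have "\<dots> \<le> A ^ k * ?R"
      using R[OF True] A by (simp add: mult.assoc)
    also have "\<dots> \<le> A ^ k * (1 + S) * ?R"
      using A S R0 by (intro mult_right_mono) auto
    finally show ?thesis by (simp add: mult.assoc)
  next
    case False
    have "t ^ (k - m) * (\<rho> ^ (n - (k + 1 - i)) * \<alpha> i)
        = t ^ (k - i) * \<rho> ^ (n - (k + 1 - i)) * (t ^ (i - m) * \<alpha> i)"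
      using False i by (simp add: mult_ac flip: power_add)
    also have "\<dots> \<le> A ^ k * \<rho> ^ e m * (S * \<alpha> m)"
    proof (rule mult_mono)
      have "e m \<le> k - i + (n - (k + 1 - i))"
        using False i e(2)[of m] by linarith
      then show "t ^ (k - i) * \<rho> ^ (n - (k + 1 - i)) \<le> A ^ k * \<rho> ^ e m"
        by (intro tpow) auto
    qed (use False i inv[of i] t \<alpha> \<rho> A in auto)
    also have "\<dots> = A ^ k * S * (\<rho> ^ e m * \<alpha> m)"
      by (simp add: mult_ac)
    also have "\<dots> \<le> A ^ k * (1 + S) * ?R"
      using R[of m] R0 A S \<rho> \<alpha> by (intro mult_mono) auto
    finally show ?thesis .
  qed
  then have "t ^ (k - m) * (\<Sum>i<k + 1. \<rho> ^ (n - (k + 1 - i)) * \<alpha> i)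
      \<le> (\<Sum>i<k + 1. A ^ k * (1 + S) * ?R)"
    unfolding sum_distrib_left by (intro sum_mono) auto
  also have "\<dots> = (real k + 1) * A ^ k * (1 + S) * ?R"
    by (simp only: sum_constant card_lessThan of_nat_add of_nat_1 mult.assoc)
  finally show ?thesis .
qed

context bounded_open_set
begin

lemma L2_seminorm_cmult:
  assumes f: "smooth_on UNIV f"
  shows "L2_seminorm j (\<lambda>x. c * f x) = \<bar>c\<bar> * L2_seminorm j f"
proof -
  have "mderiv \<alpha> (\<lambda>x. c * f x) = (\<lambda>x. c * mderiv \<alpha> f x)" for \<alpha>
    unfolding mderiv_def by (rule pderivs_cmult[OF f])
  then show ?thesis
    by (simp add: L2_seminorm_def power_mult_distrib real_sqrt_mult flip: sum_distrib_left)
qed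

end

section \<open>Explicit constants\<close>

definition power_const :: "nat \<Rightarrow> real \<Rightarrow> nat \<Rightarrow> real" where
  "power_const k A n = (2 ^ (k + 1) * A) ^ n + real n * A ^ n"

text \<open>The power of 2 comes from \<open>pderivs_mult_bound\<close>; 1 + S merges the term with
  all derivatives on \<open>chi\<close> into the term of one order less.\<close>

definition leibniz_const :: "nat \<Rightarrow> real \<Rightarrow> real \<Rightarrow> nat \<Rightarrow> real" where
  "leibniz_const k A S n = 2 ^ (k + 1) * power_const k A n * (1 + S)"

text \<open>The factor 2^k pays for splitting \<rho>^j. The first two summands belong to the part
  |c|^j, the last two to (h/d)^j. Summing the Leibniz constants over all j <= k makes the result
  independent of j.\<close>

definition recursion_const :: "nat \<Rightarrow> real \<Rightarrow> real \<Rightarrow> real \<Rightarrow> real \<Rightarrow> real" where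
  "recursion_const k A S D V =
     2 ^ k * (2 * D + 2 * D * V * (\<Sum>j\<le>k. leibniz_const k A S j) + S * D + D)"

text \<open>The first line is the constant of \<open>sup_seminorm_high_order\<close>. In the second,
  D serves the first inequality, and the Gronwall constant, times the largest possible number of
  orders, serves the second.\<close>

definition superapprox_const :: "nat \<Rightarrow> nat \<Rightarrow> real \<Rightarrow> real \<Rightarrow> real \<Rightarrow> real \<Rightarrow> real" where
  "superapprox_const k n A S D V = leibniz_const k A S n * ((real k + 1) * A ^ k * (1 + S)) *
     (D + (real k + 1) * (2 * recursion_const k A S D V * (1 + recursion_const k A S D V) ^ k))"

lemma power_const_nonneg: "A \<ge> 0 \<Longrightarrow> power_const k A n \<ge> 0"
  by (simp add: power_const_def)

lemma leibniz_const_nonneg: "A \<ge> 0 \<Longrightarrow> S \<ge> 0 \<Longrightarrow> leibniz_const k A S n \<ge> 0"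
  by (simp add: leibniz_const_def power_const_nonneg)

lemma recursion_const_nonneg:
  "A \<ge> 0 \<Longrightarrow> S \<ge> 0 \<Longrightarrow> D \<ge> 0 \<Longrightarrow> V \<ge> 0 \<Longrightarrow> recursion_const k A S D V \<ge> 0"
  by (simp add: recursion_const_def leibniz_const_nonneg sum_nonneg)

lemma superapprox_const_nonneg:
  "A \<ge> 0 \<Longrightarrow> S \<ge> 0 \<Longrightarrow> D \<ge> 0 \<Longrightarrow> V \<ge> 0 \<Longrightarrow> superapprox_const k n A S D V \<ge> 0"
  by (simp add: superapprox_const_def leibniz_const_nonneg recursion_const_nonneg)

text \<open>In the application \<open>c\<close> is the mean of \<open>\<omega>\<close>, \<open>s = h\<^bsup>N/2\<^esup>\<close>, and \<open>\<rho>\<close> is comparable to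
  \<open>\<bar>c\<bar> + h / d\<close>, normalised to be at most 1: it measures the size of \<open>\<omega>\<close> on \<open>U\<close>.\<close>

locale superapproximation = bounded_open_set U for U :: "(real ^ 'n::finite) set" +
  fixes \<omega> chi :: "real ^ 'n \<Rightarrow> real" and d h \<rho> c A S D V s :: real and k :: nat
  assumes smooth_\<omega>: "smooth_on UNIV \<omega>" and smooth_chi: "smooth_on UNIV chi"
    and d: "d > 0" and h: "h > 0" and \<rho>: "\<rho> > 0" "\<rho> \<le> 1" and A: "A \<ge> 1"
    and S: "S \<ge> 0" and D: "D \<ge> 0" and V: "V \<ge> 0" and s: "s > 0"
    and h_le: "h / d \<le> A * \<rho>" and c_le: "\<bar>c\<bar> \<le> A * \<rho>" and \<rho>_le: "\<rho> \<le> \<bar>c\<bar> + h / d"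
    and \<omega>_le: "\<And>x. x \<in> U \<Longrightarrow> \<bar>\<omega> x\<bar> \<le> A * \<rho>"
    and \<omega>_deriv_le: "\<And>xs x. x \<in> U \<Longrightarrow> xs \<noteq> [] \<Longrightarrow> \<bar>pderivs xs \<omega> x\<bar> \<le> A / d ^ length xs"
    and \<omega>_diff_le: "\<And>x. x \<in> U \<Longrightarrow> \<bar>\<omega> x - c\<bar> \<le> A * (h / d)"
    and inverse_estimate: "\<And>p q. p < q \<Longrightarrow> q \<le> k + 1 \<Longrightarrow>
          h ^ (q - p) * sup_seminorm q chi \<le> S * sup_seminorm p chi"
    and sup_le_L2: "\<And>p. p \<le> k \<Longrightarrow> s * sup_seminorm p chi \<le> D * L2_seminorm p chi"
    and L2_le_sup: "\<And>f l. smooth_on UNIV f \<Longrightarrow> l \<le> k + 1 \<Longrightarrow>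
          L2_seminorm l f \<le> V * s * sup_seminorm l f"
begin

text \<open>Each differentiation uses up at most one factor \<omega>, so at least n - l factors of
  size A \<rho> survive l derivatives; truncated subtraction covers l > n. The bound j on the length
  is fixed in advance so that the base of the constant is the same throughout the induction.\<close>

lemma pderivs_power_bound:
  assumes "x \<in> U" "length xs \<le> j"
  shows "\<bar>pderivs xs (\<lambda>x. \<omega> x ^ n) x\<bar> \<le> (2 ^ j * A) ^ n / d ^ length xs * \<rho> ^ (n - length xs)"
  using assms(2)
proof (induction n arbitrary: xs)
  case 0
  then show ?case
    using d by (cases "xs = []") (auto simp: pderivs_const)
next
  case (Suc n)
  let ?l = "length xs"
  let ?M = "A * (2 ^ j * A) ^ n / d ^ ?l * \<rho> ^ (Suc n - ?l)"
  have "\<bar>pderivs xs (\<lambda>x. \<omega> x * \<omega> x ^ n) x\<bar> \<le> 2 ^ ?l * ?M"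
  \<comment> \<open>Since \<open>1 - i\<close> is truncated, the bounds for \<omega> itself read A
    \<rho> at order 0 and A / d^i at the orders above.\<close>
  proof (rule pderivs_mult_bound[where a = "\<lambda>i. A / d ^ i * \<rho> ^ (1 - i)"
        and b = "\<lambda>i. (2 ^ j * A) ^ n / d ^ i * \<rho> ^ (n - i)"])
    show "\<bar>pderivs ys \<omega> x\<bar> \<le> A / d ^ length ys * \<rho> ^ (1 - length ys)" for ys
      using \<omega>_le[OF assms(1)] \<omega>_deriv_le[OF assms(1), of ys]
      by (cases ys) (auto simp del: pderivs.simps(2))
    show "\<bar>pderivs ys (\<lambda>x. \<omega> x ^ n) x\<bar> \<le> (2 ^ j * A) ^ n / d ^ length ys * \<rho> ^ (n - length ys)"
      if "length ys \<le> ?l" for ys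
      using Suc that by (intro Suc.IH) auto
    show "A / d ^ (?l - i) * \<rho> ^ (1 - (?l - i)) * ((2 ^ j * A) ^ n / d ^ i * \<rho> ^ (n - i)) \<le> ?M"
      if i: "i \<le> ?l" for i
    proof -
      have "A / d ^ (?l - i) * \<rho> ^ (1 - (?l - i)) * ((2 ^ j * A) ^ n / d ^ i * \<rho> ^ (n - i))
          = A * (2 ^ j * A) ^ n / (d ^ (?l - i) * d ^ i) * (\<rho> ^ (1 - (?l - i)) * \<rho> ^ (n - i))"
        by simp
      also have "d ^ (?l - i) * d ^ i = d ^ ?l"
        using i by (simp flip: power_add)
      also have "A * (2 ^ j * A) ^ n / d ^ ?l * (\<rho> ^ (1 - (?l - i)) * \<rho> ^ (n - i)) \<le> ?M"
        unfolding power_add[symmetric] using A d \<rho> i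
        by (intro mult_left_mono power_decreasing) (auto intro: less_imp_le)
      finally show ?thesis .
    qed
  qed (auto intro: smooth_\<omega> smooth_on_power)
  also have "2 ^ ?l * ?M \<le> 2 ^ j * ?M"
    using Suc.prems A d \<rho> by (intro mult_right_mono power_increasing) auto
  finally show ?case by (simp add: mult_ac)
qed

text \<open>Factor out \<omega> - c, which is at most A h/d; each of the n remaining terms is a
  product of n - 1 factors of size A \<rho>.\<close>

lemma power_diff_bound:
  assumes "x \<in> U"
  shows "\<bar>\<omega> x ^ n - c ^ n\<bar> \<le> real n * A ^ n * (h / d) * \<rho> ^ (n - 1)"
proof (cases n)
  case (Suc p)
  have "\<bar>\<Sum>i<n. c ^ (n - Suc i) * \<omega> x ^ i\<bar> \<le> (\<Sum>i<n. (A * \<rho>) ^ p)"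
  proof (rule order_trans[OF sum_abs sum_mono])
    fix i assume "i \<in> {..<n}"
    then have "(A * \<rho>) ^ (n - Suc i) * (A * \<rho>) ^ i = (A * \<rho>) ^ p"
      using Suc by (simp flip: power_add)
    moreover have "\<bar>c ^ (n - Suc i) * \<omega> x ^ i\<bar> \<le> (A * \<rho>) ^ (n - Suc i) * (A * \<rho>) ^ i"
      unfolding abs_mult power_abs
      using c_le \<omega>_le[OF assms] A \<rho> by (intro mult_mono power_mono) auto
    ultimately show "\<bar>c ^ (n - Suc i) * \<omega> x ^ i\<bar> \<le> (A * \<rho>) ^ p" by simp
  qed
  then have "\<bar>\<omega> x - c\<bar> * \<bar>\<Sum>i<n. c ^ (n - Suc i) * \<omega> x ^ i\<bar> \<le> A * (h / d) * (real n * (A * \<rho>) ^ p)"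
    using \<omega>_diff_le[OF assms] A h d by (intro mult_mono) auto
  moreover have "\<omega> x ^ n - c ^ n = (\<omega> x - c) * (\<Sum>i<n. c ^ (n - Suc i) * \<omega> x ^ i)"
    by (rule power_diff_sumr2)
  ultimately show ?thesis
    using Suc by (simp add: abs_mult power_mult_distrib mult_ac)
qed simp

text \<open>The derivative of top order hits \<open>chi\<close> with the small factor \<open>\<omega>\<^sup>n - c\<^sup>n = O(h/d)\<close>, which the inverse
  estimate trades for one order of differentiation.\<close>

lemma sup_seminorm_power_diff_mult:
  assumes n: "n \<ge> 1" and j: "1 \<le> j" "j \<le> k + 1"
  shows "d ^ j * sup_seminorm j (\<lambda>x. (\<omega> x ^ n - c ^ n) * chi x)
    \<le> leibniz_const k A S n * (\<Sum>i<j. \<rho> ^ (n - (j - i)) * (d ^ i * sup_seminorm i chi))"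
proof -
  let ?B = "power_const k A n"
  let ?M = "\<lambda>i. sup_seminorm i chi"
  let ?T = "\<lambda>i. ?B / d ^ (j - i) * \<rho> ^ (n - (j - i)) * ?M i"
  \<comment> \<open>\<open>a\<close> bounds the derivatives of \<omega>^n - c^n, with the small
    factor h/d at order 0 only. \<open>power_const\<close> adds the constants of
    \<open>pderivs_power_bound\<close> and \<open>power_diff_bound\<close>, so it dominates
    either.\<close>
  define a where "a i = (if i = 0 then ?B * (h / d) * \<rho> ^ (n - 1) else ?B / d ^ i * \<rho> ^ (n - i))" for i
  have B: "?B \<ge> 0" using A by (intro power_const_nonneg) simp
  have a: "a i \<ge> 0" for i using B h d \<rho> by (simp add: a_def)
  have T: "?T i \<ge> 0" for i using B d \<rho> sup_seminorm_nonneg by simp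
  have sm: "smooth_on UNIV (\<lambda>x. \<omega> x ^ n - c ^ n)"
    by (intro smooth_on_diff smooth_on_power smooth_on_const smooth_\<omega>)
  have eta: "\<bar>pderivs ys (\<lambda>x. \<omega> x ^ n - c ^ n) x\<bar> \<le> a (length ys)"
    if "x \<in> U" "length ys \<le> k + 1" for ys x
  proof (cases "ys = []")
    case True
    have "real n * A ^ n * (h / d) * \<rho> ^ (n - 1) \<le> ?B * (h / d) * \<rho> ^ (n - 1)"
      using A h d \<rho> by (intro mult_right_mono) (auto simp: power_const_def)
    with power_diff_bound[OF that(1), of n] True show ?thesis by (simp add: a_def)
  next
    case False
    have "pderivs ys (\<lambda>x. \<omega> x ^ n + - (c ^ n)) x = pderivs ys (\<lambda>x. \<omega> x ^ n) x"
      by (subst pderivs_add)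
        (auto intro: smooth_on_power smooth_on_const smooth_\<omega> simp: pderivs_const[OF False])
    moreover have "(2 ^ (k + 1) * A) ^ n / d ^ length ys * \<rho> ^ (n - length ys) \<le> a (length ys)"
      using False A d \<rho> by (auto simp: a_def power_const_def intro!: mult_right_mono divide_right_mono)
    ultimately show ?thesis
      using pderivs_power_bound[OF that] by (auto intro: order_trans)
  qed
  have "sup_seminorm j (\<lambda>x. (\<omega> x ^ n - c ^ n) * chi x) \<le> 2 ^ j * (\<Sum>i\<le>j. a (j - i) * ?M i)"
  proof (rule sup_seminorm_le)
    show "smooth_on UNIV (\<lambda>x. (\<omega> x ^ n - c ^ n) * chi x)"
      by (intro smooth_on_mult sm smooth_chi)
    show "0 \<le> 2 ^ j * (\<Sum>i\<le>j. a (j - i) * ?M i)"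
      by (intro mult_nonneg_nonneg sum_nonneg a sup_seminorm_nonneg) auto
    fix xs :: "'n list" and x assume xs: "length xs = j" and x: "x \<in> U"
    show "\<bar>pderivs xs (\<lambda>x. (\<omega> x ^ n - c ^ n) * chi x) x\<bar> \<le> 2 ^ j * (\<Sum>i\<le>j. a (j - i) * ?M i)"
      unfolding xs[symmetric]
    proof (rule pderivs_mult_bound[OF sm smooth_chi, of _ _ a ?M])
      show "a (length xs - i) * ?M i \<le> (\<Sum>i\<le>length xs. a (length xs - i) * ?M i)"
        if "i \<le> length xs" for i
        by (rule member_le_sum[of i]) (use that in \<open>auto intro!: mult_nonneg_nonneg a sup_seminorm_nonneg\<close>)
    qed (use xs x j in \<open>auto intro!: eta pderivs_le_sup_seminorm smooth_chi\<close>)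
  qed
  also have "(\<Sum>i\<le>j. a (j - i) * ?M i) = a 0 * ?M j + (\<Sum>i<j. a (j - i) * ?M i)"
    by (simp add: lessThan_Suc_atMost[symmetric])
  also have "(\<Sum>i<j. a (j - i) * ?M i) = (\<Sum>i<j. ?T i)"
    by (intro sum.cong) (auto simp: a_def)
  also have "a 0 * ?M j \<le> S * (\<Sum>i<j. ?T i)"
  proof -
    have "a 0 * ?M j = ?B / d * \<rho> ^ (n - 1) * (h * ?M j)"
      by (simp add: a_def)
    also have "\<dots> \<le> ?B / d * \<rho> ^ (n - 1) * (S * ?M (j - 1))"
      using inverse_estimate[of "j - 1" j] j B d \<rho> by (intro mult_left_mono) auto
    also have "\<dots> = S * ?T (j - 1)" using j by simp
    also have "\<dots> \<le> S * (\<Sum>i<j. ?T i)"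
      by (intro mult_left_mono[OF _ S] member_le_sum[of "j - 1" _ ?T] T) (use j in auto)
    finally show ?thesis .
  qed
  finally have "sup_seminorm j (\<lambda>x. (\<omega> x ^ n - c ^ n) * chi x) \<le> 2 ^ j * ((1 + S) * (\<Sum>i<j. ?T i))"
    by (simp add: algebra_simps)
  also have "\<dots> \<le> 2 ^ (k + 1) * ((1 + S) * (\<Sum>i<j. ?T i))"
    using j S by (intro mult_right_mono power_increasing mult_nonneg_nonneg sum_nonneg T) auto
  finally have "d ^ j * sup_seminorm j (\<lambda>x. (\<omega> x ^ n - c ^ n) * chi x)
      \<le> d ^ j * (2 ^ (k + 1) * ((1 + S) * (\<Sum>i<j. ?T i)))"
    using d by (intro mult_left_mono) auto
  also have "\<dots> = 2 ^ (k + 1) * (1 + S) * (\<Sum>i<j. d ^ j * ?T i)"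
    by (simp add: sum_distrib_left mult_ac)
  also have "(\<Sum>i<j. d ^ j * ?T i) = ?B * (\<Sum>i<j. \<rho> ^ (n - (j - i)) * (d ^ i * ?M i))"
    unfolding sum_distrib_left
  proof (rule sum.cong[OF refl])
    fix i assume "i \<in> {..<j}"
    then have "d ^ j = d ^ (j - i) * d ^ i" by (simp flip: power_add)
    then show "d ^ j * ?T i = ?B * (\<rho> ^ (n - (j - i)) * (d ^ i * ?M i))"
      using d by simp
  qed
  finally show ?thesis
    by (simp add: leibniz_const_def mult_ac)
qed

text \<open>Here the power of \<omega> equals the order j, so
  \<open>sup_seminorm_power_diff_mult\<close> returns the weights
  \<open>\<rho> ^ (j - (j - i))\<close>, that is \<rho>^i: the lower orders come back with their own
  weights and the recursion closes. The factors \<open>d ^ 0\<close> and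
  \<open>\<omega> x ^ 0\<close> match the shape of \<open>discrete_gronwall\<close>.\<close>

lemma weighted_sup_seminorm_recursion:
  assumes j: "j \<le> k"
  shows "\<rho> ^ j * (s * (d ^ j * sup_seminorm j chi)) \<le> recursion_const k A S D V *
    (d ^ j * L2_seminorm j (\<lambda>x. \<omega> x ^ j * chi x) + d ^ 0 * L2_seminorm 0 (\<lambda>x. \<omega> x ^ 0 * chi x) +
     (\<Sum>i<j. \<rho> ^ i * (s * (d ^ i * sup_seminorm i chi))))"
proof -
  let ?M = "\<lambda>i. sup_seminorm i chi" and ?H = "\<lambda>i. L2_seminorm i (\<lambda>x. \<omega> x ^ i * chi x)"
  let ?\<Sigma> = "\<Sum>i<j. \<rho> ^ i * (s * (d ^ i * ?M i))"
  let ?Z = "d ^ j * ?H j + ?H 0 + ?\<Sigma>"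
  let ?L = "\<Sum>j\<le>k. leibniz_const k A S j"
  have M: "?M i \<ge> 0" for i by (rule sup_seminorm_nonneg)
  have H: "?H i \<ge> 0" for i by (rule L2_seminorm_nonneg)
  have \<Sigma>: "?\<Sigma> \<ge> 0" using \<rho> s d M by (intro sum_nonneg) auto
  have L: "leibniz_const k A S i \<ge> 0" for i using A S by (intro leibniz_const_nonneg) auto
  have Z: "d ^ j * ?H j \<le> ?Z" "?H 0 \<le> ?Z" "?\<Sigma> \<le> ?Z" "0 \<le> ?Z"
    using H[of j] H[of 0] \<Sigma> d by auto
  have M0: "s * ?M 0 \<le> D * ?H 0"
    using sup_le_L2[of 0] by simp
  \<comment> \<open>The powers of d cancel, and a single inverse estimate leads from order j down to
    0. The case j = 0 is separate because inverse estimates relate distinct orders.\<close>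
  have small: "(h / d) ^ j * (s * (d ^ j * ?M j)) \<le> (S * D + D) * ?Z"
  proof (cases "j = 0")
    case True
    then have "(h / d) ^ j * (s * (d ^ j * ?M j)) \<le> D * ?H 0" using M0 by simp
    also have "\<dots> \<le> (S * D + D) * ?Z" using Z(2) H[of 0] S D by (intro mult_mono) simp_all
    finally show ?thesis .
  next
    case False
    have "(h / d) ^ j * (s * (d ^ j * ?M j)) = s * (h ^ j * ?M j)"
      using d by (simp add: power_divide)
    also have "\<dots> \<le> s * (S * ?M 0)"
      using inverse_estimate[of 0 j] False j s by (intro mult_left_mono) auto
    also have "\<dots> = S * (s * ?M 0)" by simp
    also have "\<dots> \<le> S * (D * ?H 0)" using M0 S by (rule mult_left_mono)
    also have "\<dots> = (S * D) * ?H 0" by simp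
    also have "\<dots> \<le> (S * D + D) * ?Z" using Z(2) H[of 0] S D by (intro mult_mono) simp_all
    finally show ?thesis .
  qed
  \<comment> \<open>The seminorm of \<open>chi\<close> passes to L2 before c^j \<open>chi\<close> is
    split, since the main term must be the L2 seminorm of \<omega>^j \<open>chi\<close>. The
    correction then returns to the sup seminorm, where the Leibniz estimate applies.\<close>
  have mean: "\<bar>c\<bar> ^ j * (s * (d ^ j * ?M j)) \<le> (2 * D + 2 * D * V * ?L) * ?Z"
  proof -
    let ?\<eta>chi = "\<lambda>x. (\<omega> x ^ j - c ^ j) * chi x"
    have sm: "smooth_on UNIV ?\<eta>chi" "smooth_on UNIV (\<lambda>x. \<omega> x ^ j * chi x)"
      by (intro smooth_on_mult smooth_on_diff smooth_on_power smooth_on_const smooth_\<omega> smooth_chi)+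
    have eta: "s * (d ^ j * sup_seminorm j ?\<eta>chi) \<le> ?L * ?\<Sigma>"
    proof (cases "j = 0")
      case True
      have "sup_seminorm 0 (\<lambda>x. 0::real) \<le> 0"
        by (rule sup_seminorm_le) (auto intro: smooth_on_const)
      with True show ?thesis using sup_seminorm_nonneg[of 0 "\<lambda>x. 0"] by simp
    next
      case False
      have "d ^ j * sup_seminorm j ?\<eta>chi
          \<le> leibniz_const k A S j * (\<Sum>i<j. \<rho> ^ (j - (j - i)) * (d ^ i * ?M i))"
        using False j by (intro sup_seminorm_power_diff_mult) auto
      also have "(\<Sum>i<j. \<rho> ^ (j - (j - i)) * (d ^ i * ?M i)) = (\<Sum>i<j. \<rho> ^ i * (d ^ i * ?M i))"
        by (intro sum.cong) auto
      finally have "s * (d ^ j * sup_seminorm j ?\<eta>chi)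
          \<le> s * (leibniz_const k A S j * (\<Sum>i<j. \<rho> ^ i * (d ^ i * ?M i)))"
        using s by (intro mult_left_mono) auto
      also have "\<dots> = leibniz_const k A S j * ?\<Sigma>"
        by (simp add: sum_distrib_left mult_ac)
      also have "\<dots> \<le> ?L * ?\<Sigma>"
        using j L \<Sigma> by (intro mult_right_mono member_le_sum) auto
      finally show ?thesis .
    qed
    have "\<bar>c\<bar> ^ j * L2_seminorm j chi = L2_seminorm j (\<lambda>x. c ^ j * chi x)"
      by (simp add: L2_seminorm_cmult[OF smooth_chi] power_abs)
    also have "(\<lambda>x. c ^ j * chi x) = (\<lambda>x. \<omega> x ^ j * chi x - ?\<eta>chi x)"
      by (simp add: algebra_simps)
    also have "L2_seminorm j \<dots> \<le> 2 * (?H j + L2_seminorm j ?\<eta>chi)"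
      by (rule L2_seminorm_diff_le[OF sm(2,1)])
    also have "L2_seminorm j ?\<eta>chi \<le> V * s * sup_seminorm j ?\<eta>chi"
      using j by (intro L2_le_sup sm) auto
    finally have cH: "\<bar>c\<bar> ^ j * L2_seminorm j chi \<le> 2 * (?H j + V * s * sup_seminorm j ?\<eta>chi)"
      by simp
    have "\<bar>c\<bar> ^ j * (s * (d ^ j * ?M j)) = \<bar>c\<bar> ^ j * d ^ j * (s * ?M j)"
      by (simp add: mult_ac)
    also have "\<dots> \<le> \<bar>c\<bar> ^ j * d ^ j * (D * L2_seminorm j chi)"
      using sup_le_L2[OF j] d by (intro mult_left_mono) auto
    also have "\<dots> = D * d ^ j * (\<bar>c\<bar> ^ j * L2_seminorm j chi)"
      by (simp add: mult_ac)
    also have "\<dots> \<le> D * d ^ j * (2 * (?H j + V * s * sup_seminorm j ?\<eta>chi))"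
      using cH D d by (intro mult_left_mono) auto
    also have "\<dots> = 2 * D * (d ^ j * ?H j) + 2 * D * V * (s * (d ^ j * sup_seminorm j ?\<eta>chi))"
      by (simp add: algebra_simps)
    also have "\<dots> \<le> 2 * D * ?Z + 2 * D * V * (?L * ?Z)"
      using eta Z D V L
      by (intro add_mono mult_left_mono order_trans[OF eta] sum_nonneg) auto
    finally show ?thesis by (simp add: algebra_simps)
  qed
  have "\<rho> ^ j \<le> (\<bar>c\<bar> + h / d) ^ j"
    using \<rho> \<rho>_le by (intro power_mono) auto
  also have "\<dots> \<le> (2 * max \<bar>c\<bar> (h / d)) ^ j"
    using h d by (intro power_mono) auto
  also have "\<dots> \<le> 2 ^ j * (\<bar>c\<bar> ^ j + (h / d) ^ j)"
    using h d by (auto simp: power_mult_distrib max_def)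
  also have "\<dots> \<le> 2 ^ k * (\<bar>c\<bar> ^ j + (h / d) ^ j)"
    using j h d by (intro mult_right_mono power_increasing) auto
  finally have "\<rho> ^ j * (s * (d ^ j * ?M j)) \<le> 2 ^ k * (\<bar>c\<bar> ^ j + (h / d) ^ j) * (s * (d ^ j * ?M j))"
    using s d M by (intro mult_right_mono) auto
  also have "\<dots> = 2 ^ k * (\<bar>c\<bar> ^ j * (s * (d ^ j * ?M j)) + (h / d) ^ j * (s * (d ^ j * ?M j)))"
    by (simp add: algebra_simps)
  also have "\<dots> \<le> 2 ^ k * ((2 * D + 2 * D * V * ?L) * ?Z + (S * D + D) * ?Z)"
    using mean small by (intro mult_left_mono add_mono) auto
  also have "\<dots> = recursion_const k A S D V * ?Z"
    by (simp add: recursion_const_def algebra_simps)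
  finally show ?thesis by simp
qed

text \<open>The prefactor (h/d)^(k - m) is the surplus that interpolation of order k + 1 has over
  the claimed order m + 1. The exponents \<open>e\<close> stay open so that both inequalities share
  the argument.\<close>

lemma sup_seminorm_high_order:
  assumes n: "n \<ge> 1" and m: "m \<le> k"
    and e: "\<And>i. e i \<le> i" "\<And>i. e i + (m + 1) \<le> n + i \<or> e i = 0"
  shows "(h / d) ^ (k - m) * (d ^ (k + 1) * (s * sup_seminorm (k + 1) (\<lambda>x. (\<omega> x ^ n - c ^ n) * chi x)))
    \<le> leibniz_const k A S n * ((real k + 1) * A ^ k * (1 + S)) *
      (\<Sum>i\<le>m. \<rho> ^ e i * (s * (d ^ i * sup_seminorm i chi)))"
proof -
  let ?M = "\<lambda>i. d ^ i * sup_seminorm i chi"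
  let ?\<eta> = "sup_seminorm (k + 1) (\<lambda>x. (\<omega> x ^ n - c ^ n) * chi x)"
  have L: "leibniz_const k A S n \<ge> 0" using A S by (intro leibniz_const_nonneg) auto
  have "(h / d) ^ (k - m) * (d ^ (k + 1) * ?\<eta>)
      \<le> (h / d) ^ (k - m) * (leibniz_const k A S n * (\<Sum>i<k + 1. \<rho> ^ (n - (k + 1 - i)) * ?M i))"
    using n h d by (intro mult_left_mono sup_seminorm_power_diff_mult) auto
  also have "\<dots> = leibniz_const k A S n * ((h / d) ^ (k - m) * (\<Sum>i<k + 1. \<rho> ^ (n - (k + 1 - i)) * ?M i))"
    by (simp only: mult_ac)
  also have "\<dots> \<le> leibniz_const k A S n * ((real k + 1) * A ^ k * (1 + S) * (\<Sum>i\<le>m. \<rho> ^ e i * ?M i))"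
  proof (intro mult_left_mono[OF _ L] absorb_high_orders)
    show "?M i \<ge> 0" for i using d sup_seminorm_nonneg by auto
    show "(h / d) ^ (i - m) * ?M i \<le> S * ?M m" if i: "m < i" "i \<le> k" for i
    proof -
      have "d ^ i = d ^ (i - m) * d ^ m" using i by (simp flip: power_add)
      then have "(h / d) ^ (i - m) * ?M i = d ^ m * (h ^ (i - m) * sup_seminorm i chi)"
        using d by (simp add: power_divide)
      also have "\<dots> \<le> d ^ m * (S * sup_seminorm m chi)"
        using inverse_estimate[of m i] i d by (intro mult_left_mono) auto
      finally show ?thesis by (simp add: mult_ac)
    qed
  qed (use h d h_le \<rho> A S m e in auto)
  finally have "s * ((h / d) ^ (k - m) * (d ^ (k + 1) * ?\<eta>)) \<le>
      s * (leibniz_const k A S n * ((real k + 1) * A ^ k * (1 + S) * (\<Sum>i\<le>m. \<rho> ^ e i * ?M i)))"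
    using s by (intro mult_left_mono) auto
  also have "\<dots> = leibniz_const k A S n * ((real k + 1) * A ^ k * (1 + S)) * (\<Sum>i\<le>m. \<rho> ^ e i * (s * ?M i))"
    by (simp add: sum_distrib_left mult_ac)
  finally show ?thesis by (simp only: mult_ac)
qed

text \<open>With \<open>e = 0\<close> the sup seminorms of \<open>chi\<close> pass directly to L2 by
  \<open>sup_le_L2\<close>. With \<open>e i = i\<close>, admissible for n >= m + 1, the Gronwall
  argument bounds the sup seminorms weighted by \<rho>^i.\<close>

lemma superapproximation_estimate:
  assumes n: "n \<ge> 1" and m: "m \<le> k"
  shows "(h / d) ^ (k - m) * (d ^ (k + 1) * (s * sup_seminorm (k + 1) (\<lambda>x. (\<omega> x ^ n - c ^ n) * chi x)))
    \<le> superapprox_const k n A S D V * (\<Sum>i\<le>m. d ^ i * L2_seminorm i chi)"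
    and "n \<ge> m + 1 \<Longrightarrow>
      (h / d) ^ (k - m) * (d ^ (k + 1) * (s * sup_seminorm (k + 1) (\<lambda>x. (\<omega> x ^ n - c ^ n) * chi x)))
    \<le> superapprox_const k n A S D V * (\<Sum>i\<le>m. d ^ i * L2_seminorm i (\<lambda>x. \<omega> x ^ i * chi x))"
proof -
  let ?lhs = "(h / d) ^ (k - m) *
    (d ^ (k + 1) * (s * sup_seminorm (k + 1) (\<lambda>x. (\<omega> x ^ n - c ^ n) * chi x)))"
  let ?L = "leibniz_const k A S n * ((real k + 1) * A ^ k * (1 + S))"
  let ?E = "recursion_const k A S D V"
  let ?R = "(real k + 1) * (2 * ?E * (1 + ?E) ^ k)"
  have L: "?L \<ge> 0" using A S leibniz_const_nonneg[of A S k n] by auto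
  have E: "?E \<ge> 0" using A S D V by (intro recursion_const_nonneg) auto
  have C: "superapprox_const k n A S D V = ?L * (D + ?R)"
    by (simp add: superapprox_const_def)
  have le_C: "?L * (X * G) \<le> superapprox_const k n A S D V * G" if "X \<le> D + ?R" "G \<ge> 0" for X G
    unfolding C mult.assoc[of ?L] using that L by (intro mult_left_mono mult_right_mono) auto
  show "?lhs \<le> superapprox_const k n A S D V * (\<Sum>i\<le>m. d ^ i * L2_seminorm i chi)"
  proof -
    let ?G = "\<Sum>i\<le>m. d ^ i * L2_seminorm i chi"
    have "?lhs \<le> ?L * (\<Sum>i\<le>m. \<rho> ^ 0 * (s * (d ^ i * sup_seminorm i chi)))"
      using sup_seminorm_high_order[OF n m, of "\<lambda>_. 0"] by simp
    also have "\<dots> \<le> ?L * (\<Sum>i\<le>m. D * (d ^ i * L2_seminorm i chi))"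
    proof (intro mult_left_mono[OF _ L] sum_mono)
      fix i assume "i \<in> {..m}"
      then have "d ^ i * (s * sup_seminorm i chi) \<le> d ^ i * (D * L2_seminorm i chi)"
        using m d by (intro mult_left_mono sup_le_L2) auto
      then show "\<rho> ^ 0 * (s * (d ^ i * sup_seminorm i chi)) \<le> D * (d ^ i * L2_seminorm i chi)"
        by (simp add: mult_ac)
    qed
    also have "\<dots> = ?L * (D * ?G)" by (simp add: sum_distrib_left)
    also have "\<dots> \<le> superapprox_const k n A S D V * ?G"
      using E d by (intro le_C) (auto intro!: sum_nonneg L2_seminorm_nonneg mult_nonneg_nonneg)
    finally show ?thesis .
  qed
  show "?lhs \<le> superapprox_const k n A S D V * (\<Sum>i\<le>m. d ^ i * L2_seminorm i (\<lambda>x. \<omega> x ^ i * chi x))"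
    if nm: "n \<ge> m + 1"
  proof -
    let ?\<gamma> = "\<lambda>i. d ^ i * L2_seminorm i (\<lambda>x. \<omega> x ^ i * chi x)"
    let ?G = "\<Sum>i\<le>m. ?\<gamma> i"
    let ?X = "\<lambda>i. \<rho> ^ i * (s * (d ^ i * sup_seminorm i chi))"
    have \<gamma>: "?\<gamma> i \<ge> 0" for i using d L2_seminorm_nonneg by auto
    then have G: "?G \<ge> 0" by (intro sum_nonneg)
    have X: "?X j \<le> 2 * ?E * (1 + ?E) ^ k * ?G" if j: "j \<le> m" for j
    proof -
      have "?X j \<le> 2 * ?E * (1 + ?E) ^ j * (\<Sum>i\<le>j. ?\<gamma> i)"
        using j m by (intro discrete_gronwall[OF E \<gamma>, of m ?X] weighted_sup_seminorm_recursion) auto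
      also have "\<dots> \<le> 2 * ?E * (1 + ?E) ^ k * ?G"
        using j m E \<gamma> by (intro mult_mono mult_left_mono power_increasing sum_mono2 sum_nonneg) auto
      finally show ?thesis .
    qed
    have "?lhs \<le> ?L * (\<Sum>i\<le>m. ?X i)"
      using nm by (intro sup_seminorm_high_order[OF n m]) auto
    also have "\<dots> \<le> ?L * (\<Sum>i\<le>m. 2 * ?E * (1 + ?E) ^ k * ?G)"
      using X by (intro mult_left_mono[OF _ L] sum_mono) auto
    also have "\<dots> = ?L * ((real m + 1) * (2 * ?E * (1 + ?E) ^ k) * ?G)"
      by (simp add: mult_ac)
    also have "\<dots> \<le> superapprox_const k n A S D V * ?G"
    proof (rule le_C[OF _ G])
      have "(real m + 1) * (2 * ?E * (1 + ?E) ^ k) \<le> ?R"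
        using m E by (intro mult_right_mono) auto
      with D show "(real m + 1) * (2 * ?E * (1 + ?E) ^ k) \<le> D + ?R" by simp
    qed
    finally show ?thesis .
  qed
qed

end

section \<open>Interpolation on a finite element\<close>

lemma finite_element_polynomial_Cinf:
  assumes "finite_element K P \<N>" "p \<in> P"
  shows "smooth_on UNIV p" "p \<in> Cinf K"
proof -
  show "smooth_on UNIV p"
    using assms by (auto simp: finite_element_def intro: smooth_on_real_polynomial_function)
  then show "p \<in> Cinf K"
    by (auto simp: Cinf_def)
qed

lemma finite_element_add_scale:
  assumes "finite_element K P \<N>" "p \<in> P" "q \<in> P"
  shows "(\<lambda>x. p x + q x) \<in> P" "(\<lambda>x. c * p x) \<in> P"
proof -
  have sub: "fun_space.subspace P" using assms(1) by (simp add: finite_element_def)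
  show "(\<lambda>x. p x + q x) \<in> P"
    using fun_space.subspace_add[OF sub assms(2,3)] by (simp add: plus_fun_def)
  show "(\<lambda>x. c * p x) \<in> P"
    using fun_space.subspace_scale[OF sub assms(2)] by simp
qed

text \<open>Point evaluations are linear forms on \<open>P\<close>, hence combinations of the nodal variables.\<close>

lemma finite_element_unisolvent:
  assumes FE: "finite_element K P \<N>" and p: "p \<in> P" and q: "q \<in> P"
    and eq: "\<And>\<nu>. \<nu> \<in> \<N> \<Longrightarrow> \<nu> p = \<nu> q"
  shows "p = q"
proof
  fix x
  let ?L = "\<lambda>f. if f \<in> P then f x else 0"
  have "?L \<in> dual_space P"
    by (auto simp: dual_space_def linear_form_on_def finite_element_add_scale[OF FE])
  then have "?L \<in> fun_space.span (restrict_form P ` \<N>)"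
    using FE by (simp add: finite_element_def basis_of_dual_def)
  then have "?L p = ?L q"
  proof (rule fun_space.span_induct[where P = "\<lambda>L. L p = L q"])
    show "fun_space.subspace {L. L p = L q}"
      by (rule fun_space.subspaceI) auto
    show "L p = L q" if "L \<in> restrict_form P ` \<N>" for L
      using that p q eq by (auto simp: restrict_form_def)
  qed
  with p q show "p x = q x" by simp
qed

text \<open>Both sides lie in P and have the same nodal values, so unisolvence applies. This lets
  c^n \<open>chi\<close> be split off before interpolating.\<close>

lemma nodal_interpolation_add_polynomial:
  assumes FE: "finite_element K P \<N>" and Pi: "nodal_interpolation K P \<N> Pi_K"
    and \<zeta>: "\<zeta> \<in> Cinf K" "(\<lambda>x. \<zeta> x + p x) \<in> Cinf K" and p: "p \<in> P"
  shows "Pi_K (\<lambda>x. \<zeta> x + p x) = (\<lambda>x. Pi_K \<zeta> x + p x)"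
proof (rule finite_element_unisolvent[OF FE])
  have Pi\<zeta>: "Pi_K \<zeta> \<in> P" "Pi_K (\<lambda>x. \<zeta> x + p x) \<in> P"
    using Pi \<zeta> by (auto simp: nodal_interpolation_def)
  then show "Pi_K (\<lambda>x. \<zeta> x + p x) \<in> P" "(\<lambda>x. Pi_K \<zeta> x + p x) \<in> P"
    using finite_element_add_scale(1)[OF FE _ p] by auto
  fix \<nu> assume \<nu>: "\<nu> \<in> \<N>"
  have lin: "linear_form_on (Cinf K) \<nu>"
    using FE \<nu> by (simp add: finite_element_def)
  have "\<nu> (Pi_K (\<lambda>x. \<zeta> x + p x)) = \<nu> (\<lambda>x. \<zeta> x + p x)"
    using Pi \<zeta> \<nu> by (simp add: nodal_interpolation_def)
  also have "\<dots> = \<nu> \<zeta> + \<nu> p"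
    using lin \<zeta>(1) finite_element_polynomial_Cinf(2)[OF FE p] by (simp add: linear_form_on_def)
  also have "\<nu> \<zeta> = \<nu> (Pi_K \<zeta>)"
    using Pi \<zeta>(1) \<nu> unfolding nodal_interpolation_def by metis
  also have "\<nu> (Pi_K \<zeta>) + \<nu> p = \<nu> (\<lambda>x. Pi_K \<zeta> x + p x)"
    using lin Pi\<zeta>(1) finite_element_polynomial_Cinf(2)[OF FE] p by (simp add: linear_form_on_def)
  finally show "\<nu> (Pi_K (\<lambda>x. \<zeta> x + p x)) = \<nu> (\<lambda>x. Pi_K \<zeta> x + p x)" .
qed

section \<open>Size of the element in terms of its diameter\<close>

lemma diameter_pos_if_interior_nonempty:
  fixes K :: "'a::euclidean_space set"
  assumes "bounded K" "interior K \<noteq> {}"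
  shows "diameter K > 0"
proof -
  obtain x e where e: "e > 0" "cball x e \<subseteq> K"
    using assms(2) by (metis ex_in_conv mem_interior_cball)
  obtain b :: 'a where b: "b \<in> Basis" using nonempty_Basis by blast
  have "dist x (x + e *\<^sub>R b) \<le> diameter K"
    using e b by (intro diameter_bounded_bound[OF assms(1)] subsetD[OF e(2)]) (auto simp: dist_norm)
  with e b show ?thesis by (simp add: dist_norm)
qed

lemma measure_interior_le_diameter:
  fixes K :: "'a::euclidean_space set"
  assumes K: "bounded K" and x: "x \<in> K"
  shows "measure lebesgue (interior K) \<le> unit_ball_vol (real DIM('a)) * diameter K ^ DIM('a)"
proof -
  have "interior K \<subseteq> cball x (diameter K)"
    using diameter_bounded_bound[OF K x] interior_subset[of K] by auto
  then have "measure lebesgue (interior K) \<le> measure lebesgue (cball x (diameter K))"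
    by (intro measure_mono_fmeasurable) auto
  also have "\<dots> = unit_ball_vol (real DIM('a)) * diameter K ^ DIM('a)"
    using content_cball[OF diameter_ge_0[OF K]] by simp
  finally show ?thesis .
qed

text \<open>The sum over all orders up to k + 1 lets one constant, depending only on the dimension
  and k, serve every order.\<close>

definition L2_sup_const :: "'n::finite itself \<Rightarrow> nat \<Rightarrow> real" where
  "L2_sup_const _ k = sqrt (real (\<Sum>l\<le>k + 1. card {\<alpha>::'n \<Rightarrow> nat. sum \<alpha> UNIV = l}) *
     unit_ball_vol (real CARD('n)))"

lemma L2_sup_const_nonneg: "L2_sup_const TYPE('n::finite) k \<ge> 0"
  unfolding L2_sup_const_def by (intro real_sqrt_ge_zero mult_nonneg_nonneg of_nat_0_le_iff) auto

text \<open>K lies in a ball of radius h about any of its points, so its interior has volume at most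
  a constant times h^N. The square root gives the power h^(N/2), the reciprocal of the one in
  \<open>A8\<close>.\<close>

lemma L2_seminorm_le_diameter:
  fixes K :: "(real ^ 'n::finite) set"
  assumes K: "bounded K" "interior K \<noteq> {}" and f: "smooth_on UNIV f" and l: "l \<le> k + 1"
  shows "bounded_open_set.L2_seminorm (interior K) l f \<le>
    L2_sup_const TYPE('n) k * diameter K powr (real CARD('n) / 2) *
    bounded_open_set.sup_seminorm (interior K) l f"
proof -
  interpret bounded_open_set "interior K"
    using K bounded_interior by unfold_locales auto
  let ?card = "\<lambda>l. card {\<alpha>::'n \<Rightarrow> nat. sum \<alpha> UNIV = l}"
  obtain x where x: "x \<in> K" using K(2) interior_subset by blast
  have h: "diameter K > 0" by (rule diameter_pos_if_interior_nonempty[OF K])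
  have "?card l \<le> (\<Sum>l\<le>k + 1. ?card l)"
    using l by (intro member_le_sum) auto
  then have "real (?card l) * measure lebesgue (interior K)
      \<le> real (\<Sum>l\<le>k + 1. ?card l) * (unit_ball_vol (real CARD('n)) * diameter K ^ CARD('n))"
    using measure_interior_le_diameter[OF K(1) x] by (intro mult_mono) (auto simp del: of_nat_sum)
  then have "sqrt (real (?card l) * measure lebesgue (interior K))
      \<le> L2_sup_const TYPE('n) k * sqrt (diameter K ^ CARD('n))"
    unfolding L2_sup_const_def real_sqrt_mult[symmetric]
    by (intro real_sqrt_le_mono) (simp add: mult.assoc)
  also have "sqrt (diameter K ^ CARD('n)) = diameter K powr (real CARD('n) / 2)"
    using h by (simp add: powr_half_sqrt[symmetric] powr_realpow[symmetric] powr_powr)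
  finally show ?thesis
    using L2_seminorm_le_sup_seminorm[OF f, of l] sup_seminorm_nonneg[of l f]
    by (meson mult_right_mono order_trans)
qed

text \<open>The error is bounded in sup norms at order k + 1; passing to L2 costs a factor s =
  h^(N/2), which is the s on the left of \<open>superapproximation_estimate\<close>.\<close>

lemma interpolation_error_estimate:
  fixes \<omega> :: "real ^ 'n::finite \<Rightarrow> real" and C_dag C_flat C_sharp C_diamond d :: real and k n :: nat
  assumes n: "n \<ge> 1" and C: "C_dag > 0" "C_flat > 0" "C_sharp > 0" "C_diamond > 0"
    and \<omega>: "smooth_on UNIV \<omega>" and d: "d > 0"
    and FE: "finite_element K P \<N>" and Pi: "nodal_interpolation K P \<N> Pi_K"
    and A1: "\<And>j. sobolev_seminorm j \<infinity> UNIV \<omega> \<le> ennreal (C_dag / d ^ j)"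
    and A2: "diameter K \<le> d"
    and A3: "\<bar>mean_on K \<omega>\<bar> \<le> C_dag"
    and A4: "Lp_norm \<infinity> (interior K) (\<lambda>x. \<omega> x - mean_on K \<omega>) \<le> ennreal (C_dag / d * diameter K)"
    and A6: "\<And>\<zeta> l. \<zeta> \<in> Cinf K \<Longrightarrow> l \<le> k + 1 \<Longrightarrow>
      sobolev_seminorm l \<infinity> (interior K) (\<lambda>x. \<zeta> x - Pi_K \<zeta> x)
        \<le> ennreal (C_flat * diameter K ^ (k + 1 - l)) * sobolev_seminorm (k + 1) \<infinity> (interior K) \<zeta>"
    and A7: "\<And>chi p q. chi \<in> P \<Longrightarrow> p < q \<Longrightarrow> q \<le> k + 1 \<Longrightarrow>
      sobolev_seminorm q \<infinity> (interior K) chi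
        \<le> ennreal (C_sharp * diameter K powi (int p - int q)) * sobolev_seminorm p \<infinity> (interior K) chi"
    and A8: "\<And>chi p. chi \<in> P \<Longrightarrow> p \<le> k \<Longrightarrow>
      sobolev_seminorm p \<infinity> (interior K) chi
        \<le> ennreal (C_diamond * diameter K powr (- (real CARD('n) / 2))) * sobolev_seminorm p 2 (interior K) chi"
    and m: "m \<le> k" and l: "l \<le> m + 1" and chi: "chi \<in> P"
    and const: "L2_sup_const TYPE('n) k * C_flat *
      superapprox_const k n (2 * max 1 C_dag) C_sharp C_diamond (L2_sup_const TYPE('n) k) \<le> const"
  shows "sobolev_seminorm l 2 (interior K) (\<lambda>x. \<omega> x ^ n * chi x - Pi_K (\<lambda>y. \<omega> y ^ n * chi y) x)
      \<le> ennreal (const * diameter K ^ (m + 1 - l) / d ^ (m + 1)) *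
        (\<Sum>j=0..m. ennreal (d ^ j) * sobolev_seminorm j 2 (interior K) chi)" (is ?first)
    and "n \<ge> m + 1 \<Longrightarrow>
      sobolev_seminorm l 2 (interior K) (\<lambda>x. \<omega> x ^ n * chi x - Pi_K (\<lambda>y. \<omega> y ^ n * chi y) x)
      \<le> ennreal (const * diameter K ^ (m + 1 - l) / d ^ (m + 1)) *
        (\<Sum>j=0..m. ennreal (d ^ j) * sobolev_seminorm j 2 (interior K) (\<lambda>x. \<omega> x ^ j * chi x))"
      (is "_ \<Longrightarrow> ?second")
proof -
  define U where "U = interior K"
  define h where "h = diameter K"
  define c where "c = mean_on K \<omega>"
  define C0 where "C0 = max 1 C_dag"
  \<comment> \<open>With A = 2 * C0 the product A \<rho> is |c| + C0 h/d, which bounds |\<omega>| on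
    U. Both summands are at most C0, hence \<rho> <= 1. The maximum with 1 in \<open>C0\<close>
    ensures h/d <= A \<rho>.\<close>
  define \<rho> where "\<rho> = (\<bar>c\<bar> + C0 * (h / d)) / (2 * C0)"
  define s where "s = h powr (real CARD('n) / 2)"
  define V where "V = L2_sup_const TYPE('n) k"
  have K: "bounded K" "interior K \<noteq> {}"
    using FE by (auto simp: finite_element_def compact_imp_bounded)
  interpret bounded_open_set U
    using K bounded_interior by unfold_locales (auto simp: U_def)
  have h: "h > 0" "h \<le> d"
    using diameter_pos_if_interior_nonempty[OF K] A2 by (auto simp: h_def)
  then have t: "0 < h / d" "h / d \<le> 1" by auto
  have C0: "C0 \<ge> 1" "C0 \<ge> C_dag" by (auto simp: C0_def)
  have \<rho>C0: "2 * C0 * \<rho> = \<bar>c\<bar> + C0 * (h / d)"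
    using C0 by (simp add: \<rho>_def)
  have s: "s > 0" using h by (simp add: s_def)
  have V: "V \<ge> 0" unfolding V_def by (rule L2_sup_const_nonneg)
  have sm_chi: "smooth_on UNIV chi"
    by (rule finite_element_polynomial_Cinf(1)[OF FE chi])
  have dist_c: "\<bar>\<omega> x - c\<bar> \<le> C_dag * (h / d)" if "x \<in> U" for x
  proof -
    have "Lp_norm \<infinity> U (\<lambda>x. \<omega> x - c) \<le> ennreal (C_dag * (h / d))"
      using A4 by (simp add: U_def c_def h_def)
    moreover have "continuous_on UNIV (\<lambda>x. \<omega> x - c)"
      by (intro smooth_on_continuous_on smooth_on_diff smooth_on_const \<omega>)
    moreover have "C_dag * (h / d) \<ge> 0"
      using C t by (intro mult_nonneg_nonneg) auto
    ultimately show ?thesis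
      using Lp_norm_infinity_le_iff[OF U_open, of "\<lambda>x. \<omega> x - c" "C_dag * (h / d)"] that by blast
  qed
  interpret superapproximation U \<omega> chi d h \<rho> c "2 * C0" C_sharp C_diamond V s k
  proof unfold_locales
    show "smooth_on UNIV \<omega>" "smooth_on UNIV chi" by fact+
    show "d > 0" "h > 0" "s > 0" "V \<ge> 0" by fact+
    show "0 < \<rho>"
      unfolding \<rho>_def using C0 t h d by (intro divide_pos_pos add_nonneg_pos mult_pos_pos) auto
    have "\<bar>c\<bar> \<le> C0" using A3 C0 by (simp add: c_def)
    moreover have "C0 * (h / d) \<le> C0 * 1" using C0 t h d by (intro mult_left_mono) auto
    ultimately show "\<rho> \<le> 1" using C0 by (simp add: \<rho>_def)
    show "1 \<le> 2 * C0" using C0 by simp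
    show "0 \<le> C_sharp" "0 \<le> C_diamond" using C by auto
    have C0t: "h / d \<le> C0 * (h / d)" using C0 t mult_right_mono[of 1 C0 "h / d"] by simp
    then show "h / d \<le> 2 * C0 * \<rho>" "\<bar>c\<bar> \<le> 2 * C0 * \<rho>"
      unfolding \<rho>C0 using t C0 by auto
    have "\<bar>c\<bar> * 1 \<le> \<bar>c\<bar> * (2 * C0)" using C0 by (intro mult_left_mono) auto
    moreover have "(h / d) * C0 \<le> (h / d) * (2 * C0)" using C0 t h d by (intro mult_left_mono) auto
    ultimately have "\<bar>c\<bar> + C0 * (h / d) \<le> (\<bar>c\<bar> + h / d) * (2 * C0)"
      by (simp add: algebra_simps)
    then show "\<rho> \<le> \<bar>c\<bar> + h / d"
      using C0 by (simp add: \<rho>_def pos_divide_le_eq)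
    have dag: "C_dag * (h / d) \<le> C0 * (h / d)"
      using C0 t h d by (intro mult_right_mono) auto
    show "\<bar>\<omega> x\<bar> \<le> 2 * C0 * \<rho>" if "x \<in> U" for x
      unfolding \<rho>C0 using dist_c[OF that] dag by linarith
    have dag2: "C0 * (h / d) \<le> 2 * C0 * (h / d)"
      using C0 t h d by (intro mult_right_mono) auto
    show "\<bar>\<omega> x - c\<bar> \<le> 2 * C0 * (h / d)" if "x \<in> U" for x
      using dist_c[OF that] dag dag2 by linarith
    show "\<bar>pderivs xs \<omega> x\<bar> \<le> 2 * C0 / d ^ length xs" for xs x
    proof -
      have "\<bar>pderivs xs \<omega> x\<bar> \<le> C_dag / d ^ length xs"
        using C d by (intro sobolev_seminorm_infinity_bound[OF open_UNIV \<omega> _ A1]) auto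
      also have "\<dots> \<le> 2 * C0 / d ^ length xs"
        using C0 d by (intro divide_right_mono) auto
      finally show ?thesis .
    qed
    show "h ^ (q - p) * sup_seminorm q chi \<le> C_sharp * sup_seminorm p chi"
      if pq: "p < q" "q \<le> k + 1" for p q
    proof -
      have "int p - int q = - int (q - p)" using pq by simp
      then have "h powi (int p - int q) = inverse (h ^ (q - p))"
        by (simp only: power_int_minus power_int_of_nat)
      then have "sobolev_seminorm q \<infinity> U chi
          \<le> ennreal (C_sharp * inverse (h ^ (q - p))) * sobolev_seminorm p \<infinity> U chi"
        using A7[OF chi pq] by (simp add: U_def h_def)
      then have "ennreal (sup_seminorm q chi)
          \<le> ennreal (C_sharp * inverse (h ^ (q - p)) * sup_seminorm p chi)"
        using C h sup_seminorm_nonneg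
        by (simp only: sobolev_seminorm_infinity_eq[OF sm_chi]) (simp add: ennreal_mult'')
      then have "sup_seminorm q chi \<le> C_sharp * inverse (h ^ (q - p)) * sup_seminorm p chi"
        using C h sup_seminorm_nonneg[of p chi] by (subst (asm) ennreal_le_iff) auto
      then have "h ^ (q - p) * sup_seminorm q chi
          \<le> h ^ (q - p) * (C_sharp * inverse (h ^ (q - p)) * sup_seminorm p chi)"
        using h by (intro mult_left_mono) auto
      also have "\<dots> = C_sharp * sup_seminorm p chi"
        using h by (simp add: field_simps)
      finally show ?thesis .
    qed
    show "s * sup_seminorm p chi \<le> C_diamond * L2_seminorm p chi" if p: "p \<le> k" for p
    proof -
      have inv: "h powr (- (real CARD('n) / 2)) = inverse s"
        unfolding s_def by (rule powr_minus)
      have "sobolev_seminorm p \<infinity> U chi \<le> ennreal (C_diamond * inverse s) * sobolev_seminorm p 2 U chi"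
        using A8[OF chi p] by (simp only: inv h_def[symmetric] U_def[symmetric])
      then have "ennreal (sup_seminorm p chi) \<le> ennreal (C_diamond * inverse s * L2_seminorm p chi)"
        using C s L2_seminorm_nonneg
        by (simp only: sobolev_seminorm_infinity_eq[OF sm_chi] sobolev_seminorm_2_eq[OF sm_chi])
          (simp add: ennreal_mult'')
      then have "sup_seminorm p chi \<le> C_diamond * inverse s * L2_seminorm p chi"
        using C s L2_seminorm_nonneg[of p chi] by (subst (asm) ennreal_le_iff) auto
      then have "s * sup_seminorm p chi \<le> s * (C_diamond * inverse s * L2_seminorm p chi)"
        using s by (intro mult_left_mono) auto
      also have "\<dots> = C_diamond * L2_seminorm p chi"
        using s by (simp add: field_simps)
      finally show ?thesis .
    qed
    show "L2_seminorm i f \<le> V * s * sup_seminorm i f" if "smooth_on UNIV f" "i \<le> k + 1" for f i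
      using L2_seminorm_le_diameter[OF K that] by (simp add: V_def s_def h_def U_def)
  qed
  \<comment> \<open>\<open>\<eta>\<close> includes the factor \<open>chi\<close>. It differs from
    \<omega>^n \<open>chi\<close> by c^n \<open>chi\<close>, an element of P, so both have the same
    interpolation error E.\<close>
  define \<eta> where "\<eta> = (\<lambda>x. (\<omega> x ^ n - c ^ n) * chi x)"
  define E where "E = (\<lambda>x. \<eta> x - Pi_K \<eta> x)"
  have sm_pow: "smooth_on UNIV (\<lambda>x. \<omega> x ^ i * chi x)" for i
    by (intro smooth_on_mult smooth_on_power \<omega> sm_chi)
  have sm_\<eta>: "smooth_on UNIV \<eta>"
    unfolding \<eta>_def by (intro smooth_on_mult smooth_on_diff smooth_on_power smooth_on_const \<omega> sm_chi)
  then have \<eta>: "\<eta> \<in> Cinf K" by (auto simp: Cinf_def)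
  then have "Pi_K \<eta> \<in> P" using Pi by (simp add: nodal_interpolation_def)
  then have sm_E: "smooth_on UNIV E"
    unfolding E_def by (intro smooth_on_diff sm_\<eta> finite_element_polynomial_Cinf(1)[OF FE])
  have split: "(\<lambda>x. \<eta> x + c ^ n * chi x) = (\<lambda>x. \<omega> x ^ n * chi x)"
    by (simp add: \<eta>_def algebra_simps)
  have "(\<lambda>x. \<omega> x ^ n * chi x) \<in> Cinf K"
    using sm_pow[of n] by (auto simp: Cinf_def)
  then have "Pi_K (\<lambda>x. \<omega> x ^ n * chi x) = (\<lambda>x. Pi_K \<eta> x + c ^ n * chi x)"
    using nodal_interpolation_add_polynomial[OF FE Pi \<eta>, of "\<lambda>x. c ^ n * chi x"] split
      finite_element_add_scale(2)[OF FE chi chi] by simp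
  then have E: "(\<lambda>x. \<omega> x ^ n * chi x - Pi_K (\<lambda>y. \<omega> y ^ n * chi y) x) = E"
    by (simp add: E_def \<eta>_def algebra_simps)
  have lk: "l \<le> k + 1" using l m by simp
  have "sobolev_seminorm l \<infinity> U E \<le> ennreal (C_flat * h ^ (k + 1 - l)) * sobolev_seminorm (k + 1) \<infinity> U \<eta>"
    using A6[OF \<eta> lk] by (simp only: E_def U_def h_def)
  then have "ennreal (sup_seminorm l E) \<le> ennreal (C_flat * h ^ (k + 1 - l) * sup_seminorm (k + 1) \<eta>)"
    using C h sup_seminorm_nonneg
    by (simp only: sobolev_seminorm_infinity_eq[OF sm_E] sobolev_seminorm_infinity_eq[OF sm_\<eta>])
      (simp add: ennreal_mult'')
  then have sup_E: "sup_seminorm l E \<le> C_flat * h ^ (k + 1 - l) * sup_seminorm (k + 1) \<eta>"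
    using C h sup_seminorm_nonneg[of "k + 1" \<eta>] by (subst (asm) ennreal_le_iff) auto
  define W where "W = superapprox_const k n (2 * C0) C_sharp C_diamond V"
  have W: "V * C_flat * W \<le> const"
    using const by (simp add: V_def W_def C0_def)
  have "k + 1 - l = (k - m) + (m + 1 - l)" using l m by simp
  then have hpow: "h ^ (k + 1 - l) = h ^ (k - m) * h ^ (m + 1 - l)" by (simp add: power_add)
  have "k + 1 = (k - m) + (m + 1)" using m by simp
  then have dpow: "d ^ (k + 1) = d ^ (k - m) * d ^ (m + 1)" by (metis power_add)
  \<comment> \<open>Of h^(k + 1 - l) the power h^(m + 1 - l) stays in the final bound; the rest is
    paired with powers of d to form the prefactor of the superapproximation estimate.\<close>
  have scale: "h ^ (k + 1 - l) = h ^ (m + 1 - l) / d ^ (m + 1) * ((h / d) ^ (k - m) * d ^ (k + 1))"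
    unfolding hpow dpow power_divide using d by (simp add: field_simps)
  have main: "L2_seminorm l E \<le> const * h ^ (m + 1 - l) / d ^ (m + 1) * G"
    if est: "(h / d) ^ (k - m) * (d ^ (k + 1) * (s * sup_seminorm (k + 1) \<eta>)) \<le> W * G"
      and G: "G \<ge> 0" for G
  proof -
    have "L2_seminorm l E \<le> V * s * sup_seminorm l E"
      by (rule L2_le_sup[OF sm_E lk])
    also have "\<dots> \<le> V * s * (C_flat * h ^ (k + 1 - l) * sup_seminorm (k + 1) \<eta>)"
      using sup_E V s by (intro mult_left_mono) auto
    also have "\<dots> = V * C_flat * (h ^ (m + 1 - l) / d ^ (m + 1)) *
        ((h / d) ^ (k - m) * (d ^ (k + 1) * (s * sup_seminorm (k + 1) \<eta>)))"
      unfolding scale by (simp only: mult_ac)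
    also have "\<dots> \<le> V * C_flat * (h ^ (m + 1 - l) / d ^ (m + 1)) * (W * G)"
      using est V C h d by (intro mult_left_mono) auto
    also have "\<dots> = V * C_flat * W * (h ^ (m + 1 - l) / d ^ (m + 1) * G)"
      by (simp only: mult_ac)
    also have "\<dots> \<le> const * (h ^ (m + 1 - l) / d ^ (m + 1) * G)"
      using W G h d by (intro mult_right_mono) auto
    finally show ?thesis by simp
  qed
  have const0: "const \<ge> 0"
  proof -
    have "W \<ge> 0"
      unfolding W_def using C0 C V by (intro superapprox_const_nonneg) auto
    then show ?thesis using W V C by (meson mult_nonneg_nonneg less_imp_le order_trans)
  qed
  \<comment> \<open>The return to extended reals is made once for both inequalities:
    \<open>g j\<close> is \<open>chi\<close> for the first and \<omega>^j \<open>chi\<close> for the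
    second.\<close>
  have conv: "sobolev_seminorm l 2 U E \<le> ennreal (const * h ^ (m + 1 - l) / d ^ (m + 1)) *
        (\<Sum>j=0..m. ennreal (d ^ j) * sobolev_seminorm j 2 U (g j))"
    if g: "\<And>j. smooth_on UNIV (g j)"
      and est: "(h / d) ^ (k - m) * (d ^ (k + 1) * (s * sup_seminorm (k + 1) \<eta>))
        \<le> W * (\<Sum>j\<le>m. d ^ j * L2_seminorm j (g j))" for g
  proof -
    let ?G = "\<Sum>j\<le>m. d ^ j * L2_seminorm j (g j)"
    have G: "?G \<ge> 0" using d L2_seminorm_nonneg by (intro sum_nonneg) auto
    have "(\<Sum>j=0..m. ennreal (d ^ j) * sobolev_seminorm j 2 U (g j)) = (\<Sum>j\<le>m. ennreal (d ^ j * L2_seminorm j (g j)))"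
      using d L2_seminorm_nonneg
      by (simp add: sobolev_seminorm_2_eq[OF g] ennreal_mult'' atLeast0AtMost)
    also have "\<dots> = ennreal ?G"
      using d L2_seminorm_nonneg by (intro sum_ennreal) auto
    finally have "ennreal (const * h ^ (m + 1 - l) / d ^ (m + 1)) *
        (\<Sum>j=0..m. ennreal (d ^ j) * sobolev_seminorm j 2 U (g j)) =
        ennreal (const * h ^ (m + 1 - l) / d ^ (m + 1) * ?G)"
      by (simp only: ennreal_mult''[OF G])
    then show ?thesis
      using main[OF est G] by (simp only: sobolev_seminorm_2_eq[OF sm_E] ennreal_leI)
  qed
  show ?first
    unfolding E using conv[of "\<lambda>_. chi"] sm_chi superapproximation_estimate(1)[OF n m]
    by (simp only: U_def h_def W_def \<eta>_def)
  show ?second if "n \<ge> m + 1"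
    unfolding E using conv[of "\<lambda>j x. \<omega> x ^ j * chi x"] sm_pow superapproximation_estimate(2)[OF n m that]
    by (simp only: U_def h_def W_def \<eta>_def)
qed

section \<open>Choice of a constant uniform in \<omega>, d and the element\<close>

theorem theorem1:
  fixes k n :: nat and C_dag C_flat C_sharp C_diamond :: real
  assumes "k \<ge> 1" and "n \<ge> 1"
    and "C_dag > 0" and "C_flat > 0" and "C_sharp > 0" and "C_diamond > 0"
  shows "\<exists>C::real. C > 0 \<and>
    (\<forall>(\<omega> :: real ^ 'n::finite \<Rightarrow> real) (d::real) K P \<N> Pi_K.
       smooth_on UNIV \<omega> \<and> d > 0 \<and>
       finite_element K P \<N> \<and> nodal_interpolation K P \<N> Pi_K \<and>
       (\<forall>j. sobolev_seminorm j \<infinity> UNIV \<omega> \<le> ennreal (C_dag / d ^ j)) \<and>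
       diameter K \<le> d \<and>
       \<bar>mean_on K \<omega>\<bar> \<le> C_dag \<and>
       Lp_norm \<infinity> (interior K) (\<lambda>x. \<omega> x - mean_on K \<omega>) \<le> ennreal (C_dag / d * diameter K) \<and>
       (\<forall>\<zeta>\<in>P. \<forall>x\<in>K. \<zeta> x - Pi_K \<zeta> x = 0) \<and>
       (\<forall>\<zeta>\<in>Cinf K. \<forall>l\<le>k + 1.
          sobolev_seminorm l \<infinity> (interior K) (\<lambda>x. \<zeta> x - Pi_K \<zeta> x)
            \<le> ennreal (C_flat * diameter K ^ (k + 1 - l)) * sobolev_seminorm (k + 1) \<infinity> (interior K) \<zeta>) \<and>
       (\<forall>chi\<in>P. \<forall>s\<in>{2, \<infinity>}. \<forall>p q. p < q \<and> q \<le> k + 1 \<longrightarrow>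
          sobolev_seminorm q s (interior K) chi
            \<le> ennreal (C_sharp * diameter K powi (int p - int q)) * sobolev_seminorm p s (interior K) chi) \<and>
       (\<forall>chi\<in>P. \<forall>p\<le>k.
          sobolev_seminorm p \<infinity> (interior K) chi
            \<le> ennreal (C_diamond * diameter K powr (- (real CARD('n) / 2))) * sobolev_seminorm p 2 (interior K) chi)
       \<longrightarrow>
       (\<forall>m\<le>k. \<forall>l\<le>m + 1.
          (\<forall>chi\<in>P.
             sobolev_seminorm l 2 (interior K)
                 (\<lambda>x. \<omega> x ^ n * chi x - Pi_K (\<lambda>y. \<omega> y ^ n * chi y) x)
               \<le> ennreal (C * diameter K ^ (m + 1 - l) / d ^ (m + 1)) *
                 (\<Sum>j=0..m. ennreal (d ^ j) * sobolev_seminorm j 2 (interior K) chi)) \<and>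
          (n \<ge> m + 1 \<longrightarrow>
           (\<forall>chi\<in>P.
             sobolev_seminorm l 2 (interior K)
                 (\<lambda>x. \<omega> x ^ n * chi x - Pi_K (\<lambda>y. \<omega> y ^ n * chi y) x)
               \<le> ennreal (C * diameter K ^ (m + 1 - l) / d ^ (m + 1)) *
                 (\<Sum>j=0..m. ennreal (d ^ j) * sobolev_seminorm j 2 (interior K) (\<lambda>x. \<omega> x ^ j * chi x))))))"
proof -
  let ?V = "L2_sup_const TYPE('n) k"
  \<comment> \<open>The summand 1 makes the constant strictly positive, while the rest is only known
    to be nonnegative here.\<close>
  let ?C = "?V * C_flat * superapprox_const k n (2 * max 1 C_dag) C_sharp C_diamond ?V + 1"
  have "?V \<ge> 0" by (rule L2_sup_const_nonneg)
  then have "superapprox_const k n (2 * max 1 C_dag) C_sharp C_diamond ?V \<ge> 0"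
    using assms by (intro superapprox_const_nonneg) auto
  with \<open>?V \<ge> 0\<close> assms have "?C > 0"
    by (intro add_nonneg_pos mult_nonneg_nonneg) auto
  moreover have "?V * C_flat * superapprox_const k n (2 * max 1 C_dag) C_sharp C_diamond ?V \<le> ?C"
    by simp
  note estimates = interpolation_error_estimate[OF assms(2-6) _ _ _ _ _ _ _ _ _ _ _ _ _ _ this]
  ultimately show ?thesis
    by (intro exI[of _ ?C] conjI allI impI ballI; (elim conjE)?; (rule estimates)?) auto
qed

end
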